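(* Suppose that $W\in\mathbb{R}^{n\times n}$ is a symmetric positive semidefinite (SPSD) matrix, $r$ and $n$ are two positive integers, $r<n$, $\epsilon$ is a positive number, and $\mathcal I\subset[n]$ is the output of the Main Algorithm (described in the context) applied to $W$ with $K=r$ and tolerance $\epsilon$. Write $C:=W_{:,\mathcal I}$, $U:=W_{\mathcal I,\mathcal I}^{-1}$, and $R:=W_{\mathcal I,:}$. Then $$\|W-CUR\|_C\le(1+\epsilon)(r+1)\,\sigma_{r+1}(W).$$ Furthermore, the Main Algorithm runs at an arithmetic cost in $O(nr^4\epsilon^{-1}\log r)$ as $\epsilon\to0$.
   Context: Notation: $[n]=\{1,\dots,n\}$. For index sets $\mathcal I,\mathcal J\subset[n]$, $W_{\mathcal I,\mathcal J}$ is the submatrix of $W$ with rows in $\mathcal I$ and columns in $\mathcal J$; $W_{:,\mathcal I}$ and $W_{\mathcal I,:}$ consist of the full columns, respectively rows, indexed by $\mathcal I$. $\sigma_j(M)$ is the $j$th largest singular value of $M$ (equal to $0$ for $j>\operatorname{rank}(M)$). $\|M\|_C=\max_{i,j}|m_{ij}|$ is the Chebyshev norm. For a $k\times l$ matrix $M$ and $1\le r\le\min\{k,l\}$, the $r$-projective volume is $v_{2,r}(M)=\prod_{j=1}^r\sigma_j(M)$; for $r=\min\{k,l\}$ it is the volume $v_2(M)$, which equals $|\det M|$ for square $M$. GECP (Gaussian elimination with complete pivoting for SPSD matrices), input an SPSD matrix $A\in\mathbb R^{n\times n}$ and a positive integer $K<n$: set $R\leftarrow A$, $\mathcal I\leftarrow\emptyset$;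 for $t=1,\dots,K$ choose $i_t\in\arg\max_{j\in[n]}|R_{j,j}|$, set $\mathcal I\leftarrow\mathcal I\cup\{i_t\}$ and $R\leftarrow R-R_{:,i_t}R_{i_t,i_t}^{-1}R_{i_t,:}$; return $\mathcal I$. Index Update, input an SPSD matrix $A\in\mathbb R^{n\times n}$, a set $\mathcal I\subset[n]$, a positive integer $r\le|\mathcal I|$, and $\epsilon>0$: run over all $i\in\mathcal I$ and all $j\in[n]\setminus\mathcal I$; for $\mathcal J=(\mathcal I\setminus\{i\})\cup\{j\}$, if $v_{2,r}(A_{\mathcal J,\mathcal J})/v_{2,r}(A_{\mathcal I,\mathcal I})>1+\epsilon$, then return $\mathcal J$ and stop. If no such pair is found, return $\mathcal I$. Main Algorithm, input an SPSD matrix $A\in\mathbb R^{n\times n}$, integers $0<r\le K<n$, and $\epsilon>0$ (with $K=r$ if $K$ is not specified): set $\mathcal I$ to the output of GECP$(A,K)$; repeatedly compute $\mathcal J=$ Index Update$(A,\mathcal I,r,\epsilon)$ and replace $\mathcal I$ by $\mathcal J$, until $\mathcal J=\mathcal I$; return $\mathcal I$. In the cost estimate GECP is counted at $O(nK^2)$ operations, and in Index Update with $K=r$ each volume $v_2(A_{\mathcal J,\mathcal J})$ is computed by a small-rank update of $v_2(A_{\mathcal I,\mathcal I})$ rather than from scratch.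
   Formalization: In the cost bound, log r is read as log max(2, r), since for r = 1 the literal bound would be zero while the algorithm does spend operations; GECP is assumed to meet no zero pivot (rank W at least r), so that the inverses it uses exist. *)

theory Defs
  imports
    "HOL-Library.Monad_Syntax"
    "HOL-Library.While_Combinator"
    "Jordan_Normal_Form.Char_Poly"
    "Jordan_Normal_Form.DL_Submatrix"
    "Jordan_Normal_Form.Gauss_Jordan_Elimination"
    Complex_Main
begin

text \<open>Rows and columns are numbered from 0, so the index range is \<open>{..<n}\<close>.\<close>

section \<open>Matrices, singular values, volumes\<close>

definition spsd :: "nat \<Rightarrow> real mat \<Rightarrow> bool" where
  "spsd n A \<longleftrightarrow> A \<in> carrier_mat n n \<and> A\<^sup>T = A
     \<and> (\<forall>x \<in> carrier_vec n. 0 \<le> x \<bullet> (A *\<^sub>v x))"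

definition cheb_norm :: "real mat \<Rightarrow> real" where
  "cheb_norm M = Max {\<bar>M $$ (i,j)\<bar> | i j. i < dim_row M \<and> j < dim_col M}"

text \<open>The list contains the square roots of all eigenvalues of \<open>M\<^sup>T M\<close>, with algebraic multiplicity and
  in decreasing order. Singular values are numbered from 1.\<close>

definition singular_values :: "real mat \<Rightarrow> real list" where
  "singular_values M = map sqrt (rev (sorted_list_of_multiset (proots (char_poly (M\<^sup>T * M)))))"

definition singular_value :: "real mat \<Rightarrow> nat \<Rightarrow> real" where
  "singular_value M j =
     (if 1 \<le> j \<and> j \<le> length (singular_values M) then singular_values M ! (j - 1) else 0)"

definition proj_volume :: "nat \<Rightarrow> real mat \<Rightarrow> real" where
  "proj_volume r M = (\<Prod>j=1..r. singular_value M j)"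

section \<open>The algorithms\<close>

text \<open>The algorithms are relations between input and output, because ties between pivots and the order
  in which the pairs are visited are left open. A run of GECP that meets the pivot 0 has no output,
  since its inverse does not exist.\<close>

inductive gecp_run :: "nat \<Rightarrow> real mat \<Rightarrow> nat \<Rightarrow> nat set \<Rightarrow> real mat \<Rightarrow> bool"
  for n :: nat and A :: "real mat" where
  start: "gecp_run n A 0 {} A"
| step: "\<lbrakk>gecp_run n A t I R; i < n; \<forall>j<n. \<bar>R $$ (j,j)\<bar> \<le> \<bar>R $$ (i,i)\<bar>; R $$ (i,i) \<noteq> 0\<rbrakk>
    \<Longrightarrow> gecp_run n A (Suc t) (insert i I)
          (R - mat n n (\<lambda>(k,l). R $$ (k,i) * inverse (R $$ (i,i)) * R $$ (i,l)))"

definition gecp :: "nat \<Rightarrow> real mat \<Rightarrow> nat \<Rightarrow> nat set \<Rightarrow> bool" where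
  "gecp n A K I \<longleftrightarrow> (\<exists>R. gecp_run n A K I R)"

definition improving :: "real mat \<Rightarrow> nat set \<Rightarrow> nat \<Rightarrow> real \<Rightarrow> nat set \<Rightarrow> bool" where
  "improving A I r \<epsilon> J \<longleftrightarrow>
     proj_volume r (submatrix A J J) / proj_volume r (submatrix A I I) > 1 + \<epsilon>"

definition index_update :: "nat \<Rightarrow> real mat \<Rightarrow> nat set \<Rightarrow> nat \<Rightarrow> real \<Rightarrow> nat set \<Rightarrow> bool" where
  "index_update n A I r \<epsilon> J \<longleftrightarrow>
     (\<exists>i \<in> I. \<exists>j \<in> {..<n} - I. J = insert j (I - {i}) \<and> improving A I r \<epsilon> J)
     \<or> (J = I \<and> (\<forall>i \<in> I. \<forall>j \<in> {..<n} - I. \<not> improving A I r \<epsilon> (insert j (I - {i}))))"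

inductive update_loop :: "nat \<Rightarrow> real mat \<Rightarrow> nat \<Rightarrow> real \<Rightarrow> nat set \<Rightarrow> nat set \<Rightarrow> bool"
  for n :: nat and A :: "real mat" and r :: nat and \<epsilon> :: real where
  stop: "index_update n A I r \<epsilon> I \<Longrightarrow> update_loop n A r \<epsilon> I I"
| continue: "\<lbrakk>index_update n A I r \<epsilon> J; J \<noteq> I; update_loop n A r \<epsilon> J I'\<rbrakk> \<Longrightarrow> update_loop n A r \<epsilon> I I'"

definition main_algorithm :: "nat \<Rightarrow> real mat \<Rightarrow> nat \<Rightarrow> nat \<Rightarrow> real \<Rightarrow> nat set \<Rightarrow> bool" where
  "main_algorithm n A r K \<epsilon> I \<longleftrightarrow> (\<exists>I0. gecp n A K I0 \<and> update_loop n A r \<epsilon> I0 I)"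

section \<open>Arithmetic cost\<close>

text \<open>A computation returns a value and the number of arithmetic operations spent on it. Only the
  primitive operations below are charged, 1 each (comparisons and absolute values included). Reading
  entries and handling indices is free.\<close>

type_synonym 'a counted = "'a \<times> nat"

definition ret :: "'a \<Rightarrow> 'a counted" where
  "ret x = (x, 0)"

definition bind_counted :: "'a counted \<Rightarrow> ('a \<Rightarrow> 'b counted) \<Rightarrow> 'b counted" where
  "bind_counted m f = (fst (f (fst m)), snd m + snd (f (fst m)))"

adhoc_overloading Monad_Syntax.bind \<rightleftharpoons> bind_counted

definition add_c :: "real \<Rightarrow> real \<Rightarrow> real counted" where "add_c x y = (x + y, 1)"
definition sub_c :: "real \<Rightarrow> real \<Rightarrow> real counted" where "sub_c x y = (x - y, 1)"
definition mul_c :: "real \<Rightarrow> real \<Rightarrow> real counted" where "mul_c x y = (x * y, 1)"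
definition div_c :: "real \<Rightarrow> real \<Rightarrow> real counted" where "div_c x y = (x / y, 1)"
definition neg_c :: "real \<Rightarrow> real counted" where "neg_c x = (- x, 1)"
definition abs_c :: "real \<Rightarrow> real counted" where "abs_c x = (\<bar>x\<bar>, 1)"
definition less_c :: "real \<Rightarrow> real \<Rightarrow> bool counted" where "less_c x y = (x < y, 1)"

text \<open>Fills an array: every entry is computed, and paid for, exactly once.\<close>

definition tabulate :: "'a list \<Rightarrow> ('a \<Rightarrow> real counted) \<Rightarrow> ('a \<Rightarrow> real) counted" where
  "tabulate xs f = ((\<lambda>x. if x \<in> set xs then fst (f x) else 0), (\<Sum>x\<leftarrow>xs. snd (f x)))"

fun sum_c :: "'a list \<Rightarrow> ('a \<Rightarrow> real counted) \<Rightarrow> real counted" where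
  "sum_c [] f = ret 0"
| "sum_c (x # xs) f = do { a \<leftarrow> f x; s \<leftarrow> sum_c xs f; add_c a s }"

text \<open>The first index, in the order of the list \<open>b # xs\<close>, that maximises \<open>\<bar>d x\<bar>\<close>.\<close>

fun argmax_c :: "(nat \<Rightarrow> real) \<Rightarrow> nat \<Rightarrow> nat list \<Rightarrow> nat counted" where
  "argmax_c d b [] = ret b"
| "argmax_c d b (x # xs) =
     do { u \<leftarrow> abs_c (d b); v \<leftarrow> abs_c (d x); g \<leftarrow> less_c u v; argmax_c d (if g then x else b) xs }"

text \<open>GECP without forming the residual \<open>R\<close>. The state consists of the pivots, of the diagonal of \<open>R\<close>, and,
  for every step, of the pivot column \<open>c\<close> of \<open>R\<close> together with \<open>g = c / pivot\<close>, so that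
  \<open>R = A - (\<Sum> c g\<^sup>T)\<close>. Step \<open>t\<close> scans the diagonal in the order \<open>pv t\<close>.\<close>

type_synonym gecp_state = "nat list \<times> (nat \<Rightarrow> real) \<times> ((nat \<Rightarrow> real) \<times> (nat \<Rightarrow> real)) list"

fun gecp_c :: "nat \<Rightarrow> real mat \<Rightarrow> (nat \<Rightarrow> nat list) \<Rightarrow> nat \<Rightarrow> gecp_state counted" where
  "gecp_c n A pv 0 = ret ([], \<lambda>k. A $$ (k,k), [])"
| "gecp_c n A pv (Suc t) = do {
     (is, d, fs) \<leftarrow> gecp_c n A pv t;
     i \<leftarrow> argmax_c d (hd (pv t)) (tl (pv t));
     c \<leftarrow> tabulate [0..<n] (\<lambda>k. do {
            s \<leftarrow> sum_c fs (\<lambda>(c', g'). mul_c (c' k) (g' i));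
            sub_c (A $$ (k,i)) s });
     g \<leftarrow> tabulate [0..<n] (\<lambda>k. div_c (c k) (d i));
     d' \<leftarrow> tabulate [0..<n] (\<lambda>k. do { q \<leftarrow> mul_c (c k) (g k); sub_c (d k) q });
     ret (i # is, d', (c, g) # fs) }"

text \<open>Gauss-Jordan exchange steps. After the pivots \<open>ks\<close> the table represents \<open>y = A x\<close> (restricted to
  the indices \<open>is\<close>) solved for \<open>x\<close> on \<open>ks\<close> in place of \<open>y\<close>. Hence for \<open>ks = is\<close> one obtains the inverse,
  and the product of the pivots is the determinant.\<close>

fun exchange_c :: "nat list \<Rightarrow> nat list \<Rightarrow> (nat \<times> nat \<Rightarrow> real) \<Rightarrow> real
    \<Rightarrow> ((nat \<times> nat \<Rightarrow> real) \<times> real) counted" where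
  "exchange_c is [] B v = ret (B, v)"
| "exchange_c is (k # ks) B v = do {
     v' \<leftarrow> mul_c v (B (k,k));
     B' \<leftarrow> tabulate (List.product is is) (\<lambda>(i,j).
        if i = k \<and> j = k then div_c 1 (B (k,k))
        else if i = k then do { q \<leftarrow> div_c (B (k,j)) (B (k,k)); neg_c q }
        else if j = k then div_c (B (i,k)) (B (k,k))
        else do { p \<leftarrow> mul_c (B (i,k)) (B (k,j)); q \<leftarrow> div_c p (B (k,k)); sub_c (B (i,j)) q });
     exchange_c is ks B' v' }"

text \<open>Passing from \<open>I\<close> to \<open>J = I - {i} \<union> {j}\<close> changes the matrix \<open>A\<^sub>I\<^sub>I\<close> by rank at most 2. With
  \<open>M\<close> its inverse, \<open>v\<close> its determinant, \<open>b = A\<^sub>I\<^sub>j\<close> and \<open>y = M b\<close>, the determinant lemma gives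
  \<open>det A\<^sub>J\<^sub>J = v (M\<^sub>i\<^sub>i (A\<^sub>j\<^sub>j - b\<^sup>T y) + y\<^sub>i\<^sup>2)\<close>, which is the volume, \<open>A\<^sub>J\<^sub>J\<close> being positive semidefinite.\<close>

definition swapped_volume_c ::
    "real mat \<Rightarrow> nat list \<Rightarrow> (nat \<times> nat \<Rightarrow> real) \<Rightarrow> real \<Rightarrow> nat \<Rightarrow> nat \<Rightarrow> real counted" where
  "swapped_volume_c A is M v i j = do {
     y \<leftarrow> tabulate is (\<lambda>k. sum_c is (\<lambda>l. mul_c (M (k,l)) (A $$ (l,j))));
     q \<leftarrow> sum_c is (\<lambda>k. mul_c (A $$ (k,j)) (y k));
     s \<leftarrow> sub_c (A $$ (j,j)) q;
     a \<leftarrow> mul_c (M (i,i)) s;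
     b \<leftarrow> mul_c (y i) (y i);
     m \<leftarrow> add_c a b;
     mul_c v m }"

fun search_c :: "real mat \<Rightarrow> nat list \<Rightarrow> (nat \<times> nat \<Rightarrow> real) \<Rightarrow> real \<Rightarrow> real \<Rightarrow> (nat \<times> nat) list
    \<Rightarrow> (nat \<times> nat) option counted" where
  "search_c A is M v \<theta> [] = ret None"
| "search_c A is M v \<theta> ((i,j) # ps) = do {
     v' \<leftarrow> swapped_volume_c A is M v i j;
     q \<leftarrow> div_c v' v;
     b \<leftarrow> less_c \<theta> q;
     if b then ret (Some (i,j)) else search_c A is M v \<theta> ps }"

text \<open>Index Update for \<open>r = \<bar>I\<bar>\<close>, with \<open>I\<close> given as a list. The result is \<open>None\<close> if no pair is found.\<close>

definition index_update_c ::
    "real mat \<Rightarrow> nat list \<Rightarrow> (nat \<times> nat) list \<Rightarrow> real \<Rightarrow> nat list option counted" where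
  "index_update_c A is ps \<epsilon> = do {
     (M, v) \<leftarrow> exchange_c is is (\<lambda>p. A $$ p) 1;
     \<theta> \<leftarrow> add_c 1 \<epsilon>;
     found \<leftarrow> search_c A is M v \<theta> ps;
     ret (map_option (\<lambda>(i,j). j # remove1 i is) found) }"

text \<open>Main Algorithm with \<open>K = r\<close>. The state of the loop is whether it goes on, the current indices, and
  the number of operations so far. \<open>None\<close> means that the loop does not terminate.\<close>

definition main_c :: "nat \<Rightarrow> real mat \<Rightarrow> (nat \<Rightarrow> nat list) \<Rightarrow> (nat list \<Rightarrow> (nat \<times> nat) list)
    \<Rightarrow> nat \<Rightarrow> real \<Rightarrow> nat list counted option" where
  "main_c n A pv po r \<epsilon> =
     map_option snd
       (while_option fst
          (\<lambda>(_, is, c). case index_update_c A is (po is) \<epsilon> of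
               (None, c') \<Rightarrow> (False, is, c + c')
             | (Some js, c') \<Rightarrow> (True, js, c + c'))
          (case gecp_c n A pv r of ((is, _), c) \<Rightarrow> (True, is, c)))"

text \<open>The orders in which the implementation visits the diagonal and the pairs are arbitrary. All
  choices the algorithm leaves open are realised by some orders.\<close>

definition visiting_orders ::
    "nat \<Rightarrow> (nat \<Rightarrow> nat list) \<Rightarrow> (nat list \<Rightarrow> (nat \<times> nat) list) \<Rightarrow> bool" where
  "visiting_orders n pv po \<longleftrightarrow>
     (\<forall>t. distinct (pv t) \<and> set (pv t) = {..<n})
     \<and> (\<forall>is. distinct (po is) \<and> set (po is) = set is \<times> ({..<n} - set is))"

end

theory Submission
  imports Defs
begin

text \<open>Everything is reduced to elimination steps \<open>A \<mapsto> schur A k\<close>. Each step subtracts a square from the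
  form \<open>x\<^sup>T A x\<close>, so it preserves positive semidefiniteness, and the principal minor on the pivots is the
  product of the pivots.

  Error: \<open>W - C U R\<close> is the residual after eliminating \<open>I\<close>, so its largest entry is some diagonal
  entry \<open>s\<close> at \<open>j \<notin> I\<close>. Let \<open>K = I \<union> {j}\<close>. For \<open>i \<in> K\<close> let \<open>\<tau>\<close> be the pivot left at \<open>i\<close> once
  \<open>K - {i}\<close> is eliminated, then \<open>x\<^sup>T W x \<ge> \<tau> x\<^sub>i\<^sup>2\<close> for \<open>x\<close> supported in \<open>K\<close>. Since no exchange
  improves the volume by more than \<open>1 + \<epsilon>\<close>, \<open>\<tau> \<ge> s / (1 + \<epsilon>)\<close>. Summing over \<open>i\<close> bounds the form from
  below on \<open>r + 1\<close> coordinates, and the minimax principle bounds the singular value.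

  Cost: expanding minors along the rank-one terms of greedy elimination shows that no \<open>r\<close>-minor
  exceeds the one chosen by GECP by more than the factor \<open>r! (r + 1)!\<close>. Every exchange gains a factor
  \<open>1 + \<epsilon>\<close>, which leaves \<open>O(r log r / \<epsilon>)\<close> exchanges of cost \<open>O(n r\<^sup>3)\<close>.\<close>

lemma sum_if_single:
  fixes f :: "'a \<Rightarrow> real"
  assumes "finite S"
  shows "(\<Sum>j\<in>S. f j * (if j = k then c else 0)) = (if k \<in> S then f k * c else 0)"
proof -
  have "(\<Sum>j\<in>S. f j * (if j = k then c else 0)) = (\<Sum>j\<in>S. if j = k then f j * c else 0)"
    by (rule sum.cong) auto
  then show ?thesis using assms by (simp add: sum.delta)
qed

section \<open>Elimination in positive semidefinite forms\<close>

definition app :: "nat \<Rightarrow> (nat \<Rightarrow> nat \<Rightarrow> real) \<Rightarrow> (nat \<Rightarrow> real) \<Rightarrow> nat \<Rightarrow> real" where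
  "app n A x i = (\<Sum>j<n. A i j * x j)"

definition qform :: "nat \<Rightarrow> (nat \<Rightarrow> nat \<Rightarrow> real) \<Rightarrow> (nat \<Rightarrow> real) \<Rightarrow> real" where
  "qform n A x = (\<Sum>i<n. x i * app n A x i)"

text \<open>Matrices are total functions vanishing outside the index range, so elimination keeps
  both the type and the numbering of the indices. Symmetry extends the vanishing from rows to
  columns.\<close>

definition psd :: "nat \<Rightarrow> (nat \<Rightarrow> nat \<Rightarrow> real) \<Rightarrow> bool" where
  "psd n A \<longleftrightarrow> (\<forall>i j. A i j = A j i) \<and> (\<forall>i j. n \<le> i \<longrightarrow> A i j = 0) \<and> (\<forall>x. 0 \<le> qform n A x)"

text \<open>For a vanishing pivot, division by 0 makes \<open>schur A k = A\<close>.\<close>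

definition schur :: "(nat \<Rightarrow> nat \<Rightarrow> real) \<Rightarrow> nat \<Rightarrow> nat \<Rightarrow> nat \<Rightarrow> real" where
  "schur A k i j = A i j - A i k * A k j / A k k"

abbreviation schurs :: "(nat \<Rightarrow> nat \<Rightarrow> real) \<Rightarrow> nat list \<Rightarrow> nat \<Rightarrow> nat \<Rightarrow> real" where
  "schurs \<equiv> foldl schur"

text \<open>For semidefinite \<open>A\<close> this is the principal minor on the listed indices, see
  \<open>minor_diag\<close>; a repeated index meets the pivot 0.\<close>

fun pivot_prod :: "(nat \<Rightarrow> nat \<Rightarrow> real) \<Rightarrow> nat list \<Rightarrow> real" where
  "pivot_prod A [] = 1"
| "pivot_prod A (k # ks) = A k k * pivot_prod (schur A k) ks"

lemma pivot_prod_append: "pivot_prod A (ks @ ls) = pivot_prod A ks * pivot_prod (schurs A ks) ls"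
  by (induction ks arbitrary: A) auto

lemma psd_sym: "psd n A \<Longrightarrow> A i j = A j i"
  by (simp add: psd_def)

lemma psd_outside: "psd n A \<Longrightarrow> n \<le> i \<or> n \<le> j \<Longrightarrow> A i j = 0"
  unfolding psd_def by metis

lemma psd_nonneg: "psd n A \<Longrightarrow> 0 \<le> qform n A x"
  by (simp add: psd_def)

lemma app_add_single:
  assumes "k < n"
  shows "app n A (\<lambda>j. x j + (if j = k then c else 0)) i = app n A x i + A i k * c"
  using assms unfolding app_def by (simp add: distrib_left sum.distrib sum_if_single)

lemma qform_add_single:
  assumes "psd n A" "k < n"
  shows "qform n A (\<lambda>j. x j + (if j = k then c else 0))
         = qform n A x + 2 * c * app n A x k + c\<^sup>2 * A k k"
proof -
  have [simp]: "(\<Sum>i<n. (if i = k then c else 0) * f i) = c * f k" for f :: "nat \<Rightarrow> real"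
    using sum_if_single[of "{..<n}" f k c] assms(2) by (simp add: mult.commute)
  have "(\<Sum>i<n. x i * (A i k * c)) = c * app n A x k"
    unfolding app_def sum_distrib_left
    by (rule sum.cong) (auto simp: psd_sym[OF assms(1), of k])
  then have "qform n A (\<lambda>j. x j + (if j = k then c else 0))
      = qform n A x + c * app n A x k + c * (app n A x k + A k k * c)"
    unfolding qform_def app_add_single[OF assms(2)]
    by (simp add: distrib_left distrib_right sum.distrib)
  then show ?thesis by (simp add: algebra_simps power2_eq_square)
qed

lemma app_schur: "app n (schur A k) x i = app n A x i - A i k / A k k * app n A x k"
  unfolding app_def schur_def sum_distrib_left
  by (simp add: left_diff_distrib sum_subtractf algebra_simps)

text \<open>Completing the square in the variable \<open>x k\<close>. For \<open>A k k = 0\<close>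
  both corrections are quotients by 0, hence 0.\<close>

lemma qform_schur:
  assumes "psd n A"
  shows "qform n A x = qform n (schur A k) x + (app n A x k)\<^sup>2 / A k k"
proof -
  have "(\<Sum>i<n. x i * (A i k / A k k * app n A x k)) = app n A x k / A k k * (\<Sum>i<n. A k i * x i)"
    unfolding sum_distrib_left
  proof (rule sum.cong)
    fix i
    show "x i * (A i k / A k k * app n A x k) = app n A x k / A k k * (A k i * x i)"
      by (simp only: psd_sym[OF assms, of i k]) simp
  qed simp
  then show ?thesis
    unfolding qform_def app_schur
    by (simp add: right_diff_distrib sum_subtractf power2_eq_square app_def[of n A x k])
qed

text \<open>The form is evaluated at the unit vector \<open>i\<close> plus \<open>c\<close> times
  the unit vector \<open>j\<close>. The case \<open>i = j\<close> yields the sign of the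
  diagonal.\<close>

lemma qform_two:
  assumes "psd n A" "i < n" "j < n"
  shows "0 \<le> A i i + 2 * c * A j i + c\<^sup>2 * A j j"
proof -
  let ?e = "\<lambda>l. 0 + (if l = i then 1 else 0 :: real)"
  have "qform n A ?e = A i i"
    using qform_add_single[OF assms(1,2), of "\<lambda>_. 0" 1] by (simp add: qform_def app_def)
  moreover have "app n A ?e j = A j i"
    using app_add_single[OF assms(2), of A "\<lambda>_. 0" 1 j] by (simp add: app_def)
  ultimately have "qform n A (\<lambda>l. ?e l + (if l = j then c else 0)) = A i i + 2 * c * A j i + c\<^sup>2 * A j j"
    using qform_add_single[OF assms(1,3), of ?e c] by simp
  then show ?thesis
    using psd_nonneg[OF assms(1), of "\<lambda>l. ?e l + (if l = j then c else 0)"] by linarith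
qed

lemma psd_diag_nonneg: "psd n A \<Longrightarrow> 0 \<le> A i i"
  using qform_two[of n A i i 0] psd_outside[of n A i i] by (cases "i < n") auto

text \<open>\<open>c = 1\<close> and \<open>c = -1\<close> in \<open>qform_two\<close> bound twice
  the modulus of \<open>A i j\<close> by \<open>A i i + A j j\<close>, so the diagonal controls
  every entry.\<close>

lemma psd_abs_le:
  assumes "psd n A" "\<And>i. i < n \<Longrightarrow> A i i \<le> m" "0 \<le> m"
  shows "\<bar>A i j\<bar> \<le> m"
proof (cases "i < n \<and> j < n")
  case True
  have "0 \<le> A i i + 2 * A j i + A j j" "0 \<le> A i i - 2 * A j i + A j j"
    using qform_two[OF assms(1), of i j 1] qform_two[OF assms(1), of i j "-1"] True by auto
  then show ?thesis
    using assms(2)[of i] assms(2)[of j] True psd_sym[OF assms(1), of i j] by linarith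
next
  case False
  then show ?thesis using psd_outside[OF assms(1), of i j] assms(3) by auto
qed

text \<open>Without its quadratic term the expression in \<open>qform_two\<close> is affine in
  \<open>c\<close>, and an affine function bounded below is constant.\<close>

lemma psd_zero_diag:
  assumes "psd n A" "A k k = 0"
  shows "A i k = 0"
proof (cases "i < n \<and> k < n")
  case True
  show ?thesis
  proof (rule ccontr)
    assume "A i k \<noteq> 0"
    moreover have "0 \<le> A i i + 2 * c * A k i" for c
      using qform_two[OF assms(1), of i k c] True assms(2) by simp
    \<comment> \<open>This \<open>c\<close> makes the affine expression equal to -1.\<close>
    from this[of "- (A i i + 1) / (2 * A k i)"]
    have "A k i \<noteq> 0 \<Longrightarrow> False" by (simp add: field_simps)
    ultimately show False using psd_sym[OF assms(1), of i k] by simp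
  qed
next
  case False
  then show ?thesis using psd_outside[OF assms(1), of i k] by auto
qed

text \<open>For a nonzero pivot, the form of \<open>schur A k\<close> at \<open>x\<close> is the
  minimum of the form of \<open>A\<close> over all changes of the coordinate
  \<open>x k\<close>.\<close>

lemma psd_schur:
  assumes "psd n A"
  shows "psd n (schur A k)"
proof (cases "A k k = 0")
  case True
  then have "schur A k = A" by (intro ext) (simp add: schur_def)
  then show ?thesis using assms by simp
next
  case False
  then have k: "k < n" using psd_outside[OF assms, of k k] by (cases "k < n") auto
  have "0 \<le> qform n (schur A k) x" for x
  proof -
    \<comment> \<open>The minimiser: moving by \<open>c\<close> along the unit vector
      \<open>k\<close> makes \<open>app n A\<close> vanish at \<open>k\<close>.\<close>
    define c where "c = - app n A x k / A k k"
    have "0 \<le> qform n A (\<lambda>j. x j + (if j = k then c else 0))"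
      by (rule psd_nonneg[OF assms])
    also have "\<dots> = qform n (schur A k) x"
      unfolding qform_add_single[OF assms k] qform_schur[OF assms, of x k]
      using False by (simp add: c_def field_simps power2_eq_square)
    finally show ?thesis .
  qed
  moreover have "schur A k i j = schur A k j i" for i j
    by (simp add: schur_def psd_sym[OF assms, of i] psd_sym[OF assms, of k j])
  moreover have "n \<le> i \<Longrightarrow> schur A k i j = 0" for i j
    using psd_outside[OF assms] by (simp add: schur_def)
  ultimately show ?thesis unfolding psd_def by blast
qed

lemma psd_schurs: "psd n A \<Longrightarrow> psd n (schurs A ks)"
  by (induction ks arbitrary: A) (auto simp: psd_schur)

lemma schur_diag_le:
  assumes "psd n A"
  shows "schur A k i i \<le> A i i"
  using psd_diag_nonneg[OF assms, of k] psd_sym[OF assms, of i k]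
  by (simp add: schur_def)

lemma qform_schurs_le: "psd n A \<Longrightarrow> qform n (schurs A ks) x \<le> qform n A x"
proof (induction ks arbitrary: A)
  case (Cons k ks)
  have "qform n (schur A k) x \<le> qform n A x"
    using qform_schur[OF Cons.prems, of x k] psd_diag_nonneg[OF Cons.prems, of k] by simp
  then show ?case using Cons.IH[OF psd_schur[OF Cons.prems, of k]] by simp
qed simp

text \<open>A step clears its pivot column; if the pivot is 0, semidefiniteness has already cleared
  that column.\<close>

lemma schurs_eliminated:
  assumes "psd n A" "k \<in> set ks"
  shows "schurs A ks i k = 0"
proof -
  \<comment> \<open>A zero column stays zero, because everything subtracted from it has the factor
    \<open>B l k\<close>.\<close>
  have keep: "schurs B ls i k = 0" if "psd n B" "\<And>i. B i k = 0" for B ls i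
    using that
  proof (induction ls arbitrary: B)
    case (Cons l ls)
    have "schur B l i k = 0" for i using Cons.prems by (simp add: schur_def)
    then show ?case using Cons psd_schur by simp
  qed simp
  obtain ls ms where ks: "ks = ls @ k # ms" using split_list[OF assms(2)] by blast
  let ?B = "schurs A ls"
  have "schur ?B k i k = 0" for i
    using psd_zero_diag[OF psd_schurs[OF assms(1)], of ls k i] by (simp add: schur_def)
  then show ?thesis
    using keep[OF psd_schur[OF psd_schurs[OF assms(1)]]] by (simp add: ks)
qed

text \<open>Each step subtracts multiples of row \<open>k\<close>, whose product with
  \<open>x\<close> is 0. Choosing \<open>x\<close> as the solution of a linear system thus exposes
  entries of the Schur complement.\<close>

lemma app_schurs:
  assumes "\<And>k. k \<in> set ks \<Longrightarrow> app n A x k = 0"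
  shows "app n (schurs A ks) x i = app n A x i"
  using assms
proof (induction ks arbitrary: A)
  case (Cons k ks)
  have "app n (schur A k) x i = app n A x i" for i
    using Cons.prems by (simp add: app_schur)
  then show ?case using Cons by simp
qed simp

section \<open>Minors\<close>

text \<open>\<open>f\<close> and \<open>g\<close> are arbitrary maps, so deleting rows or columns is
  a mere change of map, and repeated indices are covered too.\<close>

definition minor :: "nat \<Rightarrow> (nat \<Rightarrow> nat \<Rightarrow> real) \<Rightarrow> (nat \<Rightarrow> nat) \<Rightarrow> (nat \<Rightarrow> nat) \<Rightarrow> real" where
  "minor m A f g = det (mat m m (\<lambda>(i,j). A (f i) (g j)))"

text \<open>One step of block LU factorization, with the Schur complement as lower right block of
  the upper factor.\<close>

lemma det_eliminate:
  fixes T :: "nat \<Rightarrow> nat \<Rightarrow> real"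
  assumes "T 0 0 \<noteq> 0"
  shows "det (mat (Suc m) (Suc m) (\<lambda>(i,j). T i j))
     = T 0 0 * det (mat m m (\<lambda>(i,j). T (Suc i) (Suc j) - T (Suc i) 0 * T 0 (Suc j) / T 0 0))"
proof -
  let ?S = "mat m m (\<lambda>(i,j). T (Suc i) (Suc j) - T (Suc i) 0 * T 0 (Suc j) / T 0 0)"
  let ?a = "mat 1 1 (\<lambda>_. T 0 0)" and ?b = "mat 1 m (\<lambda>(i,j). T 0 (Suc j))"
  let ?c = "mat m 1 (\<lambda>(i,j). T (Suc i) 0 / T 0 0)"
  have "mat (Suc m) (Suc m) (\<lambda>(i,j). T i j)
      = four_block_mat (1\<^sub>m 1) (0\<^sub>m 1 m) ?c (1\<^sub>m m) * four_block_mat ?a ?b (0\<^sub>m m 1) ?S"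
    (is "?T = ?L * ?U")
  proof -
    have "?L * ?U = four_block_mat (1\<^sub>m 1 * ?a + 0\<^sub>m 1 m * 0\<^sub>m m 1) (1\<^sub>m 1 * ?b + 0\<^sub>m 1 m * ?S)
        (?c * ?a + 1\<^sub>m m * 0\<^sub>m m 1) (?c * ?b + 1\<^sub>m m * ?S)"
      by (rule mult_four_block_mat) auto
    also have "\<dots> = ?T"
      by (rule eq_matI)
         (use assms in \<open>auto simp: four_block_mat_def scalar_prod_def Let_def not_less_eq\<close>)
    finally show ?thesis by simp
  qed
  moreover have "det ?L = det (1\<^sub>m 1 :: real mat) * det (1\<^sub>m m :: real mat)"
    by (rule det_four_block_mat_upper_right_zero) auto
  moreover have "det ?U = det ?a * det ?S"
    by (rule det_four_block_mat_lower_left_zero) auto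
  moreover have "det ?a = T 0 0" by (simp add: det_single)
  moreover have "det (?L * ?U) = det ?L * det ?U"
    by (rule det_mult[of _ "1 + m"]) (rule four_block_carrier_mat; simp)+
  ultimately show ?thesis
    by simp
qed

lemma minor_Cons:
  assumes "A k k \<noteq> 0" "f 0 = k" "g 0 = k"
  shows "minor (Suc m) A f g = A k k * minor m (schur A k) (f \<circ> Suc) (g \<circ> Suc)"
  using det_eliminate[of "\<lambda>i j. A (f i) (g j)" m] assms
  by (simp add: minor_def schur_def)

text \<open>Elimination proceeds without row exchanges: by semidefiniteness a pivot 0 comes with a
  zero column, and then both sides vanish.\<close>

lemma minor_diag:
  assumes "psd n A"
  shows "minor (length ks) A ((!) ks) ((!) ks) = pivot_prod A ks"
  using assms
proof (induction ks arbitrary: A)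
  case Nil
  then show ?case by (simp add: minor_def)
next
  case (Cons k ks)
  have eq: "(!) (k # ks) \<circ> Suc = (!) ks" by auto
  show ?case
  proof (cases "A k k = 0")
    case True
    let ?M = "mat (Suc (length ks)) (Suc (length ks)) (\<lambda>(i,j). A ((k#ks) ! i) ((k#ks) ! j))"
    have z: "A i k = 0" for i using psd_zero_diag[OF Cons.prems True] .
    have "det ?M = (\<Sum>i<Suc (length ks). ?M $$ (i,0) * cofactor ?M i 0)"
      by (rule laplace_expansion_column) auto
    also have "\<dots> = 0" by (rule sum.neutral) (simp add: z)
    finally show ?thesis using True by (simp add: minor_def)
  next
    case False
    have "minor (Suc (length ks)) A ((!) (k # ks)) ((!) (k # ks))
      = A k k * minor (length ks) (schur A k) ((!) ks) ((!) ks)"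
      using minor_Cons[of A k "(!) (k # ks)" "(!) (k # ks)" "length ks"] False unfolding eq by simp
    then show ?thesis using Cons.IH[OF psd_schur[OF Cons.prems]] by simp
  qed
qed

text \<open>The bordered matrix with first row \<open>(1, - g)\<close> and first column \<open>(1, c)\<close> has the determinant of
  \<open>S + c g\<^sup>T\<close>. Expanding it along both gives the bound.\<close>

lemma minor_rank_one_le:
  assumes A: "\<And>i j. A i j = S i j + c i * g j"
    and c: "\<And>i. \<bar>c i\<bar> \<le> p" and g: "\<And>j. \<bar>g j\<bar> \<le> 1"
    and S: "\<And>i j. \<bar>S i j\<bar> \<le> p"
    and B: "\<And>a b. \<bar>minor m S a b\<bar> \<le> B"
  shows "\<bar>minor (Suc m) A u v\<bar> \<le> real (Suc m) * real (Suc (Suc m)) * p * B"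
proof -
  have p: "0 \<le> p" using c[of 0] by linarith
  define T where "T = (\<lambda>i j. if i = 0 then (if j = 0 then 1 else - g (v (j - 1)))
      else if j = 0 then c (u (i - 1)) else S (u (i - 1)) (v (j - 1)))"
  let ?n = "Suc (Suc m)"
  let ?T = "mat ?n ?n (\<lambda>(i,j). T i j)"
  have minorA: "minor (Suc m) A u v = det ?T"
    using det_eliminate[of T "Suc m"] by (simp add: T_def minor_def A)
  have laplace_le: "\<bar>det M\<bar> \<le> real (Suc m) * (p * B)"
    if "\<And>i. i < Suc m \<Longrightarrow> \<bar>M $$ (i,0)\<bar> \<le> p"
      "\<And>i. i < Suc m \<Longrightarrow> \<exists>a b. det (mat_delete M i 0) = minor m S a b"
      "M \<in> carrier_mat (Suc m) (Suc m)" for M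
  proof -
    have "\<bar>M $$ (i,0) * cofactor M i 0\<bar> \<le> p * B" if "i < Suc m" for i
    proof -
      have "\<bar>cofactor M i 0\<bar> \<le> B"
        using \<open>\<And>i. i < Suc m \<Longrightarrow> \<exists>a b. _ = minor m S a b\<close>[OF that] B
        by (auto simp: cofactor_def abs_mult power_abs)
      then show ?thesis using \<open>\<And>i. i < Suc m \<Longrightarrow> \<bar>M $$ (i,0)\<bar> \<le> p\<close>[OF that] p
        by (simp add: abs_mult mult_mono)
    qed
    then have "(\<Sum>i<Suc m. \<bar>M $$ (i,0) * cofactor M i 0\<bar>) \<le> (\<Sum>i<Suc m. p * B)"
      by (intro sum_mono) auto
    then show ?thesis
      unfolding laplace_expansion_column[OF that(3) zero_less_Suc]
      by (intro order.trans[OF sum_abs]) simp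
  qed
  have "\<bar>?T $$ (0,j) * cofactor ?T 0 j\<bar> \<le> real (Suc m) * (p * B)" if j: "j < ?n" for j
  proof -
    let ?M = "mat_delete ?T 0 j"
    have M: "?M = mat (Suc m) (Suc m) (\<lambda>(i,l). T (Suc i) (if l < j then l else Suc l))"
      by (rule eq_matI) (auto simp: mat_delete_def)
    have "\<bar>det ?M\<bar> \<le> real (Suc m) * (p * B)"
    proof (rule laplace_le)
      fix i assume i: "i < Suc m"
      \<comment> \<open>Column 0 of \<open>?M\<close> is the border \<open>c\<close> for
        \<open>j > 0\<close> and a column of \<open>S\<close> for \<open>j = 0\<close>. Either is
        bounded by \<open>p\<close>, and deleting it leaves a minor of \<open>S\<close>.\<close>
      show "\<bar>?M $$ (i,0)\<bar> \<le> p" unfolding M using i c S by (auto simp: T_def)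
      have "mat_delete ?M i 0 = mat m m (\<lambda>(a,b). S (u (if a < i then a else Suc a))
           (v (if Suc b < j then b else Suc b)))"
        unfolding M using i by (intro eq_matI) (auto simp: mat_delete_def T_def)
      then have "det (mat_delete ?M i 0) = minor m S (\<lambda>a. u (if a < i then a else Suc a))
           (\<lambda>b. v (if Suc b < j then b else Suc b))"
        by (simp add: minor_def)
      then show "\<exists>a b. det (mat_delete ?M i 0) = minor m S a b" by blast
    qed (simp add: M)
    moreover have "\<bar>?T $$ (0,j)\<bar> \<le> 1" using j g by (auto simp: T_def)
    ultimately have "\<bar>?T $$ (0,j)\<bar> * \<bar>det ?M\<bar> \<le> 1 * (real (Suc m) * (p * B))"
      by (intro mult_mono) auto
    then show ?thesis by (simp add: cofactor_def abs_mult power_abs)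
  qed
  then have "(\<Sum>j<?n. \<bar>?T $$ (0,j) * cofactor ?T 0 j\<bar>) \<le> (\<Sum>j<?n. real (Suc m) * (p * B))"
    by (intro sum_mono) auto
  moreover have "\<bar>det ?T\<bar> \<le> (\<Sum>j<?n. \<bar>?T $$ (0,j) * cofactor ?T 0 j\<bar>)"
    using sum_abs[of "\<lambda>j. ?T $$ (0,j) * cofactor ?T 0 j" "{..<?n}"]
      laplace_expansion_row[of ?T ?n 0] by (simp only: mat_carrier zero_less_Suc)
  ultimately show ?thesis unfolding minorA by (simp add: algebra_simps)
qed

section \<open>Greedy pivoting and the size of minors\<close>

fun greedy :: "nat \<Rightarrow> (nat \<Rightarrow> nat \<Rightarrow> real) \<Rightarrow> nat list \<Rightarrow> bool" where
  "greedy n A [] \<longleftrightarrow> True"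
| "greedy n A (k # ks) \<longleftrightarrow> k < n \<and> (\<forall>j<n. \<bar>A j j\<bar> \<le> \<bar>A k k\<bar>) \<and> greedy n (schur A k) ks"

lemma greedy_append: "greedy n A (ks @ ls) \<longleftrightarrow> greedy n A ks \<and> greedy n (schurs A ks) ls"
  by (induction ks arbitrary: A) auto

text \<open>The greedy pivot is the largest entry in modulus, so eliminating it splits off a product
  \<open>c i * g j\<close> with \<open>c\<close> bounded by the pivot and \<open>g\<close> by 1, as
  \<open>minor_rank_one_le\<close> requires. Its factors m (m + 1) accumulate to m! (m +
  1)!.\<close>

lemma minor_le_greedy:
  assumes "psd n A" "greedy n A ks" "length ks = m"
  shows "\<bar>minor m A u v\<bar> \<le> fact m * fact (Suc m) * pivot_prod A ks"
  using assms
proof (induction ks arbitrary: A m u v)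
  case Nil
  then show ?case by (simp add: minor_def)
next
  case (Cons k ks)
  obtain l where m: "m = Suc l" "length ks = l" using Cons.prems(3) by auto
  have diag: "A j j \<le> A k k" if "j < n" for j
    using Cons.prems that psd_diag_nonneg[OF Cons.prems(1)] by simp
  have Ak: "0 \<le> A k k" by (rule psd_diag_nonneg[OF Cons.prems(1)])
  have le: "\<bar>A i j\<bar> \<le> A k k" for i j
    using psd_abs_le[OF Cons.prems(1) diag Ak] .
  have "\<bar>minor (Suc l) A u v\<bar>
      \<le> real (Suc l) * real (Suc (Suc l)) * A k k * (fact l * fact (Suc l) * pivot_prod (schur A k) ks)"
  proof (rule minor_rank_one_le)
    show "A i j = schur A k i j + A i k * (A k j / A k k)" for i j
      by (simp add: schur_def)
    show "\<bar>A k j / A k k\<bar> \<le> 1" for j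
      using le[of k j] Ak by (cases "A k k = 0") (auto simp: abs_divide divide_le_eq_1)
    show "\<bar>schur A k i j\<bar> \<le> A k k" for i j
      using psd_abs_le[OF psd_schur[OF Cons.prems(1)], of k "A k k"] diag Ak
        schur_diag_le[OF Cons.prems(1), of k] by (meson order.trans)
    show "\<bar>minor l (schur A k) a b\<bar> \<le> fact l * fact (Suc l) * pivot_prod (schur A k) ks" for a b
      using Cons.IH[OF psd_schur[OF Cons.prems(1)], of k l] Cons.prems m by simp
  qed (rule le)
  then show ?case by (simp add: m algebra_simps)
qed

text \<open>The signs from rows and columns cancel. This reconciles \<open>submatrix\<close>, which
  lists an index set increasingly, with eliminations in any order.\<close>

lemma minor_permute:
  assumes p: "p permutes {0..<m}"
  shows "minor m A (f \<circ> p) (g \<circ> p) = minor m A f g"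
proof -
  have rows: "minor m A (f \<circ> p) g = signof p * minor m A f g" for A f g
  proof -
    let ?M = "mat m m (\<lambda>(i,j). A (f i) (g j))"
    have "mat m m (\<lambda>(i,j). A ((f \<circ> p) i) (g j)) = mat m m (\<lambda>(i,j). ?M $$ (p i, j))"
      using permutes_in_image[OF p] by (intro eq_matI) auto
    then show ?thesis using det_permute_rows[OF _ p, of ?M] by (simp add: minor_def)
  qed
  have transpose: "minor m A f g = minor m (\<lambda>i j. A j i) g f" for A f g
  proof -
    let ?M = "mat m m (\<lambda>(i,j). A (f i) (g j))"
    have "?M\<^sup>T = mat m m (\<lambda>(i,j). A (f j) (g i))" by (rule eq_matI) auto
    then show ?thesis using det_transpose[of ?M m] by (simp add: minor_def)
  qed
  have "minor m A (f \<circ> p) (g \<circ> p) = signof p * minor m A f (g \<circ> p)" by (rule rows)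
  also have "minor m A f (g \<circ> p) = signof p * minor m A f g"
    by (simp only: transpose[of A f] rows)
  finally show ?thesis by (cases "evenperm p") (simp_all add: sign_def del: o_apply)
qed

section \<open>From matrices to forms and principal submatrices\<close>

definition entry_fun :: "nat \<Rightarrow> real mat \<Rightarrow> nat \<Rightarrow> nat \<Rightarrow> real" where
  "entry_fun n W i j = (if i < n \<and> j < n then W $$ (i,j) else 0)"

lemma spsd_psd:
  assumes "spsd n W"
  shows "psd n (entry_fun n W)"
proof -
  have W: "W \<in> carrier_mat n n" "W\<^sup>T = W" using assms by (auto simp: spsd_def)
  have "entry_fun n W i j = entry_fun n W j i" for i j
    using W(1) arg_cong[OF W(2), of "\<lambda>M. M $$ (i,j)"] by (auto simp: entry_fun_def)
  moreover have "qform n (entry_fun n W) x = vec n x \<bullet> (W *\<^sub>v vec n x)" for x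
    using W(1) by (auto simp: qform_def app_def entry_fun_def scalar_prod_def atLeast0LessThan
        intro!: sum.cong)
  ultimately show ?thesis
    using assms unfolding psd_def spsd_def by (auto simp: entry_fun_def)
qed

lemma dims_submatrix_subset:
  assumes "I \<subseteq> {..<n}"
  shows "card {i. i < n \<and> i \<in> I} = card I"
  using assms by (intro arg_cong[of _ _ card]) auto

lemma det_submatrix:
  assumes "spsd n W" "distinct is" "set is \<subseteq> {..<n}"
  shows "det (submatrix W (set is) (set is)) = pivot_prod (entry_fun n W) is"
proof -
  let ?I = "set is" and ?k = "length is" and ?A = "entry_fun n W"
  have W: "W \<in> carrier_mat n n" using assms(1) by (simp add: spsd_def)
  have card: "card ?I = ?k" by (rule distinct_card[OF assms(2)])
  \<comment> \<open>\<open>p\<close> sends a list position to the rank of its index in the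
    increasing order used by \<open>pick\<close>, and fixes all larger numbers, as
    \<open>permutes\<close> demands.\<close>
  define p where "p = (\<lambda>a. if a < ?k then card {x\<in>?I. x < is ! a} else a)"
  have pick_p: "pick ?I (p a) = is ! a" if "a < ?k" for a
    using that pick_card_in_set[of "is ! a" ?I] by (simp add: p_def)
  have "p a < ?k" if "a < ?k" for a
  proof -
    have "{x\<in>?I. x < is ! a} \<subset> ?I" using that by (auto intro!: psubsetI dest: nth_mem)
    from psubset_card_mono[OF _ this] show ?thesis
      using that card by (simp add: p_def)
  qed
  then have "p ` {0..<?k} \<subseteq> {0..<?k}" by auto
  moreover have "inj_on p {0..<?k}"
    by (rule inj_onI) (metis pick_p assms(2) nth_eq_iff_index_eq atLeastLessThan_iff)
  ultimately have "bij_betw p {0..<?k} {0..<?k}"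
    by (simp add: bij_betw_def endo_inj_surj)
  then have "p permutes {0..<?k}"
    by (rule bij_imp_permutes) (simp add: p_def)
  then have "minor ?k ?A (pick ?I) (pick ?I) = minor ?k ?A (pick ?I \<circ> p) (pick ?I \<circ> p)"
    by (rule minor_permute[symmetric])
  also have "mat ?k ?k (\<lambda>(i,j). ?A ((pick ?I \<circ> p) i) ((pick ?I \<circ> p) j))
      = mat ?k ?k (\<lambda>(i,j). ?A (is ! i) (is ! j))"
    by (rule eq_matI) (auto simp: pick_p)
  then have "minor ?k ?A (pick ?I \<circ> p) (pick ?I \<circ> p) = minor ?k ?A ((!) is) ((!) is)"
    by (simp add: minor_def)
  also have "\<dots> = pivot_prod ?A is" by (rule minor_diag[OF spsd_psd[OF assms(1)]])
  also have "submatrix W ?I ?I = mat ?k ?k (\<lambda>(i,j). ?A (pick ?I i) (pick ?I j))"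
    using W dims_submatrix_subset[OF assms(3)] pick_in_set_le[of _ ?I] assms(3) card
    by (intro eq_matI) (auto simp: submatrix_def entry_fun_def)
  then have "minor ?k ?A (pick ?I) (pick ?I) = det (submatrix W ?I ?I)"
    by (simp add: minor_def)
  finally show ?thesis .
qed

section \<open>Real symmetric matrices\<close>

text \<open>A complex eigenvalue exists. It is real, being the quotient of a real Hermitian form by
  a squared length. Hence the real and imaginary parts of its eigenvector satisfy the same equation,
  and one of them is nonzero.\<close>

lemma symmetric_eigenvector:
  fixes S :: "real mat"
  assumes S: "S \<in> carrier_mat n n" "S\<^sup>T = S" and n: "0 < n"
  shows "\<exists>e v. v \<in> carrier_vec n \<and> v \<noteq> 0\<^sub>v n \<and> S *\<^sub>v v = e \<cdot>\<^sub>v v"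
proof -
  let ?C = "map_mat complex_of_real S"
  have C: "?C \<in> carrier_mat n n" using S by simp
  have sym: "S $$ (i,j) = S $$ (j,i)" if "i < n" "j < n" for i j
    using S that by (metis carrier_matD index_transpose_mat(1))
  obtain as where as: "char_poly ?C = (\<Prod>a\<leftarrow>as. [:- a, 1:])" "length as = n"
    using char_poly_factorized[OF C] by blast
  then obtain a as' where "as = a # as'" using n by (cases as) auto
  then have "poly (char_poly ?C) a = 0" using as by simp
  then obtain z where z: "z \<in> carrier_vec n" "z \<noteq> 0\<^sub>v n" "?C *\<^sub>v z = a \<cdot>\<^sub>v z"
    using C unfolding eigenvalue_root_char_poly[OF C, symmetric] eigenvalue_def eigenvector_def by auto
  have row: "(\<Sum>j<n. complex_of_real (S $$ (i,j)) * z $ j) = a * z $ i" if "i < n" for i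
    using arg_cong[OF z(3), of "\<lambda>w. w $ i"] S z(1) that
    by (simp add: scalar_prod_def atLeast0LessThan)
  \<comment> \<open>The Hermitian form at \<open>z\<close>, which equals its conjugate because
    \<open>S\<close> is real and symmetric.\<close>
  define h where "h = (\<Sum>i<n. \<Sum>j<n. cnj (z $ i) * (complex_of_real (S $$ (i,j)) * z $ j))"
  have "cnj h = (\<Sum>i<n. \<Sum>j<n. z $ i * (complex_of_real (S $$ (i,j)) * cnj (z $ j)))"
    by (simp add: h_def)
  also have "\<dots> = (\<Sum>j<n. \<Sum>i<n. z $ i * (complex_of_real (S $$ (i,j)) * cnj (z $ j)))"
    by (rule sum.swap)
  also have "\<dots> = h" unfolding h_def
    by (intro sum.cong refl) (use sym in auto)
  finally have "h \<in> \<real>" by (simp add: complex_is_Real_iff complex_eq_iff)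
  have "h = (\<Sum>i<n. cnj (z $ i) * (a * z $ i))"
    unfolding h_def by (intro sum.cong refl) (simp add: row flip: sum_distrib_left)
  also have "\<dots> = a * complex_of_real (\<Sum>i<n. (cmod (z $ i))\<^sup>2)"
    unfolding of_real_sum sum_distrib_left
    by (intro sum.cong refl) (simp only: complex_norm_square mult_ac)
  finally have "h = a * complex_of_real (\<Sum>i<n. (cmod (z $ i))\<^sup>2)" .
  moreover have "(\<Sum>i<n. (cmod (z $ i))\<^sup>2) \<noteq> 0"
    using z(1,2) by (subst sum_nonneg_eq_0_iff) auto
  ultimately have "a = h / complex_of_real (\<Sum>i<n. (cmod (z $ i))\<^sup>2)"
    by (simp del: of_real_sum)
  then have "a \<in> \<real>" using \<open>h \<in> \<real>\<close> by simp
  then obtain e where e: "a = complex_of_real e" by (auto elim: Reals_cases)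
  have parts: "(\<Sum>j<n. S $$ (i,j) * Re (z $ j)) = e * Re (z $ i)"
    "(\<Sum>j<n. S $$ (i,j) * Im (z $ j)) = e * Im (z $ i)" if "i < n" for i
    using arg_cong[OF row[OF that], of Re] arg_cong[OF row[OF that], of Im] e by simp_all
  have eig: "S *\<^sub>v vec n f = e \<cdot>\<^sub>v vec n f"
    if "\<And>i. i < n \<Longrightarrow> (\<Sum>j<n. S $$ (i,j) * f j) = e * f i" for f
    using S(1) that by (intro eq_vecI) (auto simp: scalar_prod_def atLeast0LessThan)
  obtain i where i: "i < n" "z $ i \<noteq> 0" using z(1,2) by (metis carrier_vecD eq_vecI index_zero_vec)
  show ?thesis
  proof (cases "Re (z $ i) = 0")
    case True
    then have "vec n (\<lambda>i. Im (z $ i)) \<noteq> 0\<^sub>v n"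
      using i by (metis complex_eqI index_vec index_zero_vec(1) zero_complex.sel)
    then show ?thesis using eig[OF parts(2)] by (metis vec_carrier)
  next
    case False
    then have "vec n (\<lambda>i. Re (z $ i)) \<noteq> 0\<^sub>v n"
      using i by (metis index_vec index_zero_vec(1))
    then show ?thesis using eig[OF parts(1)] by (metis vec_carrier)
  qed
qed

text \<open>A Householder reflection. For \<open>v = e\<^sub>0\<close> division by 0 makes it the identity.\<close>

lemma reflection_to_first_unit_vector:
  fixes v :: "real vec"
  assumes v: "v \<in> carrier_vec n" "v \<bullet> v = 1" and n: "0 < n"
  shows "\<exists>H \<in> carrier_mat n n. H\<^sup>T = H \<and> H * H = 1\<^sub>m n \<and> H *\<^sub>v v = unit_vec n 0"
proof -
  define u where "u = (\<lambda>i. v $ i - (if i = 0 then 1 else 0))"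
  define w where "w = (\<Sum>i<n. u i * u i)"
  define c where "c = 2 / w"
  define H where "H = mat n n (\<lambda>(i,j). (if i = j then 1 else 0) - c * u i * u j)"
  have H: "H \<in> carrier_mat n n" by (simp add: H_def)
  have T: "H\<^sup>T = H" by (rule eq_matI) (auto simp: H_def)
  have vv: "(\<Sum>i<n. v $ i * v $ i) = 1"
    using v by (simp add: scalar_prod_def atLeast0LessThan)
  have "w = (\<Sum>i<n. v $ i * v $ i) - 2 * (\<Sum>i<n. v $ i * (if i = 0 then 1 else 0))
      + (\<Sum>i<n. (if i = 0 then 1 else 0) * (if i = 0 then 1 else 0))"
    unfolding w_def u_def sum_distrib_left sum_subtractf[symmetric] sum.distrib[symmetric]
    by (rule sum.cong) (auto simp: algebra_simps)
  also have "\<dots> = 2 - 2 * v $ 0"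
    using vv n by (simp add: sum_if_single)
  finally have w: "w = 2 - 2 * v $ 0" .
  \<comment> \<open>With \<open>c = 2 / w\<close> the product of \<open>c\<close> and this sum is 1,
    so \<open>H\<close> maps \<open>v\<close> to \<open>v - u\<close>, the first unit
    vector.\<close>
  have uv: "(\<Sum>j<n. u j * v $ j) = w / 2"
  proof -
    have "(\<Sum>j<n. u j * v $ j) = (\<Sum>i<n. v $ i * v $ i) - (\<Sum>i<n. v $ i * (if i = 0 then 1 else 0))"
      unfolding u_def sum_subtractf[symmetric] by (rule sum.cong) (auto simp: algebra_simps)
    then show ?thesis using vv n w by (simp add: sum_if_single)
  qed
  have w0: "u i = 0" if "w = 0" "i < n" for i
    using that unfolding w_def by (subst (asm) sum_nonneg_eq_0_iff) auto
  have "H *\<^sub>v v = unit_vec n 0"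
  proof (rule eq_vecI)
    fix i assume "i < dim_vec (unit_vec n 0)"
    then have i: "i < n" by simp
    have "(H *\<^sub>v v) $ i = (\<Sum>j<n. v $ j * (if j = i then 1 else 0)) - c * u i * (\<Sum>j<n. u j * v $ j)"
      unfolding sum_distrib_left sum_subtractf[symmetric]
      using i v(1) by (auto simp: H_def scalar_prod_def atLeast0LessThan algebra_simps intro!: sum.cong)
    also have "\<dots> = v $ i - u i" using i w0 by (cases "w = 0") (auto simp: sum_if_single uv c_def)
    finally show "(H *\<^sub>v v) $ i = unit_vec n 0 $ i" using i n by (simp add: u_def)
  qed (simp add: H_def)
  moreover have "H * H = 1\<^sub>m n"
  proof (rule eq_matI)
    fix i j assume "i < dim_row (1\<^sub>m n)" "j < dim_col (1\<^sub>m n)"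
    then have ij: "i < n" "j < n" by auto
    have "(H * H) $$ (i,j) = (\<Sum>k<n. ((if i = k then 1 else 0) - c * u i * u k)
        * ((if k = j then 1 else 0) - c * u k * u j))"
      using ij by (simp add: H_def scalar_prod_def atLeast0LessThan)
    also have "\<dots> = (\<Sum>k<n. (if i = k then 1 else 0) * (if k = j then 1 else 0))
        - c * u i * (\<Sum>k<n. u k * (if k = j then 1 else 0))
        - c * u j * (\<Sum>k<n. u k * (if k = i then 1 else 0)) + c * u i * (c * u j) * w"
      unfolding w_def sum_distrib_left sum_subtractf[symmetric] sum.distrib[symmetric]
      by (rule sum.cong) (auto simp: algebra_simps)
    also have "\<dots> = (if i = j then 1 else 0)"
      using ij w0 by (cases "w = 0") (auto simp: sum_if_single c_def)
    finally show "(H * H) $$ (i,j) = 1\<^sub>m n $$ (i,j)" using ij by simp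
  qed (auto simp: H_def)
  ultimately show ?thesis using H T by blast
qed

section \<open>Orthogonal diagonalization\<close>

definition diag :: "real list \<Rightarrow> real mat" where
  "diag es = mat (length es) (length es) (\<lambda>(i,j). if i = j then es ! i else 0)"

text \<open>Deflation: reflecting a unit eigenvector to the first unit vector reduces the first
  column to its diagonal entry, symmetry does the same for the first row, and the remaining block is
  again symmetric.\<close>

lemma spectral_theorem:
  fixes S :: "real mat"
  assumes "S \<in> carrier_mat n n" "S\<^sup>T = S"
  shows "\<exists>P es. P \<in> carrier_mat n n \<and> P\<^sup>T * P = 1\<^sub>m n \<and> length es = n \<and> S = P * diag es * P\<^sup>T"
  using assms
proof (induction n arbitrary: S)
  case 0
  then show ?case
    by (intro exI[of _ "1\<^sub>m 0"] exI[of _ "[]"]) (auto intro!: eq_matI simp: diag_def)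
next
  case (Suc m)
  let ?n = "Suc m"
  note S = Suc.prems
  obtain e v0 where v0: "v0 \<in> carrier_vec ?n" "v0 \<noteq> 0\<^sub>v ?n" "S *\<^sub>v v0 = e \<cdot>\<^sub>v v0"
    using symmetric_eigenvector[OF S] by auto
  define v where "v = (1 / sqrt (v0 \<bullet> v0)) \<cdot>\<^sub>v v0"
  have pos: "0 < v0 \<bullet> v0"
  proof -
    obtain i where "i < ?n" "v0 $ i \<noteq> 0" using v0(1,2) by (metis carrier_vecD eq_vecI index_zero_vec)
    then have "0 < (\<Sum>i<?n. v0 $ i * v0 $ i)"
      by (intro sum_pos2[of _ i]) (auto simp: zero_less_mult_iff linorder_neq_iff)
    then show ?thesis using v0(1) by (simp add: scalar_prod_def atLeast0LessThan)
  qed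
  have v: "v \<in> carrier_vec ?n" "v \<bullet> v = 1" "S *\<^sub>v v = e \<cdot>\<^sub>v v"
    using v0 pos S unfolding v_def
    by (auto simp: mult_mat_vec smult_smult_assoc mult.commute)
  obtain H where H: "H \<in> carrier_mat ?n ?n" "H\<^sup>T = H" "H * H = 1\<^sub>m ?n" "H *\<^sub>v v = unit_vec ?n 0"
    using reflection_to_first_unit_vector[OF v(1,2)] by auto
  define B where "B = H * S * H"
  have B: "B \<in> carrier_mat ?n ?n" using H S by (simp add: B_def)
  have BT: "B\<^sup>T = B"
    using H S by (simp add: B_def transpose_mult[of _ ?n ?n _ ?n] assoc_mult_mat[of _ ?n ?n _ ?n _ ?n])
  have SB: "S = H * B * H"
  proof -
    have "H * B * H = (H * H) * S * (H * H)"
      using H(1) S(1) unfolding B_def by (simp add: assoc_mult_mat[of _ ?n ?n _ ?n _ ?n] del: H(3))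
    then show ?thesis using H S by simp
  qed
  have "H *\<^sub>v unit_vec ?n 0 = v"
    using H v by (metis assoc_mult_mat_vec one_mult_mat_vec)
  then have Be0: "B *\<^sub>v unit_vec ?n 0 = e \<cdot>\<^sub>v unit_vec ?n 0"
    using H S v unfolding B_def
    by (simp add: assoc_mult_mat_vec[of _ ?n ?n _ ?n] mult_mat_vec[of _ ?n ?n])
  have col: "B $$ (i,0) = (if i = 0 then e else 0)" if "i < ?n" for i
  proof -
    have "B $$ (i,0) = (B *\<^sub>v unit_vec ?n 0) $ i"
      using B that by (simp add: scalar_prod_right_unit[of _ ?n])
    then show ?thesis using that by (simp add: Be0)
  qed
  have row: "B $$ (0,i) = (if i = 0 then e else 0)" if "i < ?n" for i
    using B BT col[OF that] that by (metis carrier_matD index_transpose_mat(1) zero_less_Suc)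
  define S1 where "S1 = mat m m (\<lambda>(i,j). B $$ (Suc i, Suc j))"
  have S1: "S1 \<in> carrier_mat m m" by (simp add: S1_def)
  have "B $$ (i,j) = B $$ (j,i)" if "i < ?n" "j < ?n" for i j
    using B BT that by (metis carrier_matD index_transpose_mat(1))
  then have "S1\<^sup>T = S1" by (intro eq_matI) (auto simp: S1_def)
  from Suc.IH[OF S1 this] obtain P1 es where
    P1: "P1 \<in> carrier_mat m m" "P1\<^sup>T * P1 = 1\<^sub>m m" "length es = m" "S1 = P1 * diag es * P1\<^sup>T"
    by blast
  have D1: "diag es \<in> carrier_mat m m" using P1 by (simp add: diag_def)
  let ?E = "mat 1 1 (\<lambda>_. e)"
  have B4: "B = four_block_mat ?E (0\<^sub>m 1 m) (0\<^sub>m m 1) S1"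
  proof (rule eq_matI, goal_cases)
    case (1 i j)
    then show ?case using col[of i] row[of j] by (auto simp: S1_def)
  qed (use B in \<open>auto simp: S1_def\<close>)
  \<comment> \<open>The orthogonal matrix of the smaller block with a corner entry 1 added;
    \<open>H * ?Q\<close> then diagonalizes \<open>S\<close>.\<close>
  let ?Q = "four_block_mat (1\<^sub>m 1) (0\<^sub>m 1 m) (0\<^sub>m m 1) P1"
  have Q: "?Q \<in> carrier_mat ?n ?n" using four_block_carrier_mat[of "1\<^sub>m 1" 1 1 P1 m m] P1 by simp
  have QT: "?Q\<^sup>T = four_block_mat (1\<^sub>m 1) (0\<^sub>m 1 m) (0\<^sub>m m 1) (P1\<^sup>T)"
    using P1 by (subst transpose_four_block_mat[of _ 1 1 _ m _ m]) auto
  have diag: "diag (e # es) = four_block_mat ?E (0\<^sub>m 1 m) (0\<^sub>m m 1) (diag es)"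
    using P1(3) by (intro eq_matI) (auto simp: diag_def nth_Cons')
  have Dn: "diag (e # es) \<in> carrier_mat ?n ?n" using P1(3) by (simp add: diag_def)
  have QQ: "?Q\<^sup>T * ?Q = 1\<^sub>m ?n"
    unfolding QT using P1
    by (subst mult_four_block_mat[of _ 1 1 _ m _ m _ _ 1 _ m]) (auto intro!: eq_matI)
  have QDQ: "?Q * diag (e # es) * ?Q\<^sup>T = B"
  proof -
    have "?Q * diag (e # es) = four_block_mat ?E (0\<^sub>m 1 m) (0\<^sub>m m 1) (P1 * diag es)"
      unfolding diag using P1 D1 by (subst mult_four_block_mat[of _ 1 1 _ m _ m _ _ 1 _ m]) auto
    then show ?thesis unfolding B4 QT P1(4)
      using P1(1) D1 by (simp, subst mult_four_block_mat[of _ 1 1 _ m _ m _ _ 1 _ m]) auto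
  qed
  let ?P = "H * ?Q"
  have PT: "?P\<^sup>T = ?Q\<^sup>T * H" using H Q by (simp add: transpose_mult[of _ ?n ?n _ ?n])
  have "?P\<^sup>T * ?P = ?Q\<^sup>T * (H * H) * ?Q"
    unfolding PT using H(1) Q by (simp add: assoc_mult_mat[of _ ?n ?n _ ?n _ ?n])
  then have "?P\<^sup>T * ?P = 1\<^sub>m ?n"
    using right_mult_one_mat[of "?Q\<^sup>T" ?n ?n] H(3) Q QQ by simp
  moreover have "?P * diag (e # es) * ?P\<^sup>T = H * (?Q * diag (e # es) * ?Q\<^sup>T) * H"
    unfolding PT using H(1) Q Dn by (simp add: assoc_mult_mat[of _ ?n ?n _ ?n _ ?n])
  ultimately show ?case
    using H(1) Q P1(3) SB unfolding QDQ
    by (intro exI[of _ ?P] exI[of _ "e # es"]) auto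
qed

lemma diag_factorization:
  assumes P: "P \<in> carrier_mat n n" "P\<^sup>T * P = 1\<^sub>m n" and es: "length es = n"
    and S: "S = P * diag es * P\<^sup>T"
  shows "char_poly S = (\<Prod>a\<leftarrow>es. [:- a, 1:])" "det S = prod_list es"
proof -
  have D: "diag es \<in> carrier_mat n n" "diag_mat (diag es) = es" "upper_triangular (diag es)"
    using es by (auto simp: diag_def diag_mat_def intro!: nth_equalityI)
  have "P * P\<^sup>T = 1\<^sub>m n"
    using mat_mult_left_right_inverse[OF _ P(1) P(2)] P(1) by simp
  then have sim: "similar_mat S (diag es)"
    using P D S by (intro similar_matI[of _ _ P "P\<^sup>T" n]) auto
  show "char_poly S = (\<Prod>a\<leftarrow>es. [:- a, 1:])"
    using char_poly_similar[OF sim] char_poly_upper_triangular[OF D(1,3)] D(2) by simp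
  show "det S = prod_list es"
    using det_similar[OF sim] det_upper_triangular[OF D(3,1)] D(2) by simp
qed

section \<open>Singular values\<close>

lemma proots_linear_factors:
  fixes es :: "real list"
  shows "proots (\<Prod>a\<leftarrow>es. [:- a, 1:]) = mset es"
proof (induction es)
  case (Cons a es)
  have "(\<Prod>a\<leftarrow>es. [:- a, 1:]) \<noteq> 0" by (auto simp: prod_list_zero_iff)
  then have "proots ([:- a, 1:] * (\<Prod>a\<leftarrow>es. [:- a, 1:])) = add_mset a (mset es)"
    using Cons by (subst proots_mult) auto
  then show ?case by simp
qed simp

text \<open>The characteristic polynomial splits over the reals, so \<open>proots\<close> finds all
  \<open>n\<close> eigenvalues and the list \<open>singular_values\<close> has full length.\<close>

lemma gram_spectral:
  fixes M :: "real mat"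
  assumes "M \<in> carrier_mat m n"
  obtains P es where "P \<in> carrier_mat n n" "P\<^sup>T * P = 1\<^sub>m n" "length es = n"
    "M\<^sup>T * M = P * diag es * P\<^sup>T" "singular_values M = map sqrt (rev (sort es))"
    "det (M\<^sup>T * M) = prod_list es"
proof -
  have "(M\<^sup>T * M)\<^sup>T = M\<^sup>T * M" using assms by (simp add: transpose_mult[of _ n m _ n])
  then obtain P es where P: "P \<in> carrier_mat n n" "P\<^sup>T * P = 1\<^sub>m n" "length es = n"
    "M\<^sup>T * M = P * diag es * P\<^sup>T"
    using spectral_theorem[of "M\<^sup>T * M" n] assms by auto
  moreover have "singular_values M = map sqrt (rev (sort es))"
    unfolding singular_values_def diag_factorization(1)[OF P] proots_linear_factors by simp
  ultimately show ?thesis using that diag_factorization(2)[OF P] by blast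
qed

text \<open>All \<open>r\<close> singular values multiply to
  \<open>sqrt (det (M\<^sup>T * M))\<close>, and this determinant is the square of
  \<open>det M\<close>.\<close>

lemma proj_volume_square:
  assumes "M \<in> carrier_mat r r"
  shows "proj_volume r M = \<bar>det M\<bar>"
proof -
  obtain es where es: "length es = r" "singular_values M = map sqrt (rev (sort es))"
    "det (M\<^sup>T * M) = prod_list es"
    using gram_spectral[OF assms] by metis
  \<comment> \<open>\<open>sqrt\<close> is extended to negative reals as an odd function, which
    keeps it multiplicative.\<close>
  have sqrt: "prod_list (map sqrt xs) = sqrt (prod_list xs)" for xs
    by (induction xs) (auto simp: real_sqrt_mult)
  have "prod_list (rev (sort es)) = prod_list es"
    by (metis mset_rev mset_sort prod_mset_prod_list)
  then have "prod_list (singular_values M) = sqrt (det (M\<^sup>T * M))"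
    unfolding es by (simp add: sqrt del: rev_map prod_list.rev)
  also have "det (M\<^sup>T * M) = (det M)\<^sup>2"
    using assms by (simp add: det_mult[of _ r] det_transpose power2_eq_square)
  finally have "prod_list (singular_values M) = \<bar>det M\<bar>" by simp
  moreover have "(\<Prod>j=1..r. singular_value M j) = (\<Prod>j<r. singular_values M ! j)"
    by (rule prod.reindex_bij_witness[of _ Suc "\<lambda>j. j - 1"])
       (auto simp: singular_value_def es)
  moreover have "\<dots> = prod_list (singular_values M)"
    using prod.distinct_set_conv_list[of "[0..<r]" "(!) (singular_values M)"]
      map_nth[of "singular_values M"]
    by (simp add: es atLeast0LessThan)
  ultimately show ?thesis by (simp add: proj_volume_def)
qed

lemma length_filter_ge_less:
  fixes xs :: "real list"
  assumes "sorted (rev xs)" "0 < k" "k \<le> length xs" "xs ! (k - 1) < m"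
  shows "length (filter (\<lambda>x. m \<le> x) xs) < k"
proof -
  have "xs ! i < m" if "k - 1 \<le> i" "i < length xs" for i
    using sorted_rev_nth_mono[OF assms(1) that] assms(4) by simp
  then have "{i. i < length xs \<and> m \<le> xs ! i} \<subseteq> {..<k - 1}"
    by (metis (mono_tags, lifting) lessThan_iff mem_Collect_eq not_less subsetI)
  from card_mono[OF _ this] show ?thesis
    using assms(2) by (simp add: length_filter_conv_card)
qed

text \<open>The lower half of the Courant-Fischer theorem, for coordinate subspaces. If fewer than
  \<open>card K\<close> eigenvalues of \<open>M\<^sup>T M\<close> reached \<open>\<mu>\<^sup>2\<close>, some vector supported in \<open>K\<close> would be orthogonal to
  all their eigenvectors.\<close>

lemma singular_value_ge:
  assumes M: "M \<in> carrier_mat n n" and K: "K \<subseteq> {..<n}" "0 < card K" and \<mu>: "0 \<le> \<mu>"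
    and form: "\<And>x. (\<And>i. i \<notin> K \<Longrightarrow> x i = 0) \<Longrightarrow>
        \<mu>\<^sup>2 * (\<Sum>i<n. (x i)\<^sup>2) \<le> (\<Sum>i<n. (app n (entry_fun n M) x i)\<^sup>2)"
  shows "\<mu> \<le> singular_value M (card K)"
proof -
  obtain P es where P: "P \<in> carrier_mat n n" "P\<^sup>T * P = 1\<^sub>m n" "length es = n"
    "M\<^sup>T * M = P * diag es * P\<^sup>T" and sv: "singular_values M = map sqrt (rev (sort es))"
    using gram_spectral[OF M] by metis
  let ?k = "card K" and ?xs = "rev (sort es)"
  have fin: "finite K" using K(1) finite_subset by blast
  have kn: "?k \<le> n" using card_mono[OF _ K(1)] by simp
  have val: "singular_value M ?k = sqrt (?xs ! (?k - 1))"
    using K(2) kn P(3) by (simp add: singular_value_def sv del: rev_map)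
  show ?thesis
  proof (rule ccontr)
    assume "\<not> \<mu> \<le> singular_value M ?k"
    then have "sqrt (?xs ! (?k - 1)) < \<mu>" by (simp add: val)
    then have "?xs ! (?k - 1) < \<mu>\<^sup>2"
      using \<mu> by (metis not_le real_le_rsqrt real_sqrt_le_iff real_sqrt_abs abs_of_nonneg)
    then have "length (filter (\<lambda>x. \<mu>\<^sup>2 \<le> x) ?xs) < ?k"
      using K(2) kn P(3) by (intro length_filter_ge_less) auto
    moreover have "length (filter (\<lambda>x. \<mu>\<^sup>2 \<le> x) ?xs) = length (filter (\<lambda>x. \<mu>\<^sup>2 \<le> x) es)"
      by (metis mset_rev mset_sort mset_filter size_mset)
    moreover define idx where "idx = filter (\<lambda>i. \<mu>\<^sup>2 \<le> es ! i) [0..<n]"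
    have "length idx = length (filter (\<lambda>x. \<mu>\<^sup>2 \<le> x) es)"
      using arg_cong[OF map_nth[of es], of "\<lambda>ys. length (filter (\<lambda>x. \<mu>\<^sup>2 \<le> x) ys)"] P(3)
      by (simp add: idx_def filter_map o_def)
    ultimately have idx: "length idx < ?k" by simp
    define ks where "ks = sorted_list_of_set K"
    have ks: "distinct ks" "set ks = K" "length ks = ?k"
      using fin by (auto simp: ks_def)
    \<comment> \<open>Row \<open>a\<close> expresses orthogonality of a vector on \<open>K\<close>
      to the eigenvector \<open>idx ! a\<close>. There are fewer conditions than unknowns; zero rows
      pad the system to a square one, and the last of them makes it singular.\<close>
    define Q where "Q = mat ?k ?k (\<lambda>(a,b). if a < length idx then P $$ (ks ! b, idx ! a) else 0)"
    have Q: "Q \<in> carrier_mat ?k ?k" by (simp add: Q_def)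
    have "det Q = (\<Sum>b<?k. Q $$ (?k - 1, b) * cofactor Q (?k - 1) b)"
      using K(2) by (intro laplace_expansion_row[OF Q]) simp
    also have "\<dots> = 0"
      by (rule sum.neutral) (use idx in \<open>auto simp: Q_def\<close>)
    finally obtain v where v: "v \<in> carrier_vec ?k" "v \<noteq> 0\<^sub>v ?k" "Q *\<^sub>v v = 0\<^sub>v ?k"
      using det_0_iff_vec_prod_zero[OF Q] by blast
    define x where "x = (\<lambda>i. \<Sum>b<?k. v $ b * (if i = ks ! b then 1 else 0))"
    have sum_x: "(\<Sum>i<n. f i * x i) = (\<Sum>b<?k. v $ b * f (ks ! b))" for f
    proof -
      have "(\<Sum>i<n. f i * x i) = (\<Sum>b<?k. v $ b * (\<Sum>i<n. f i * (if i = ks ! b then 1 else 0)))"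
        unfolding x_def sum_distrib_left by (subst sum.swap) (simp add: mult_ac)
      also have "\<dots> = (\<Sum>b<?k. v $ b * f (ks ! b))"
      proof (intro sum.cong refl)
        fix b assume "b \<in> {..<?k}"
        then have "ks ! b \<in> K" using ks by (metis lessThan_iff nth_mem)
        then show "v $ b * (\<Sum>i<n. f i * (if i = ks ! b then 1 else 0)) = v $ b * f (ks ! b)"
          using K(1) by (auto simp: sum_if_single)
      qed
      finally show ?thesis .
    qed
    have x_outside: "x i = 0" if "i \<notin> K" for i
      unfolding x_def by (rule sum.neutral) (use ks that in \<open>auto dest: nth_mem\<close>)
    obtain b where b: "b < ?k" "v $ b \<noteq> 0"
      using v(1,2) by (metis carrier_vecD eq_vecI index_zero_vec)
    have "x (ks ! b) = (\<Sum>c<?k. v $ c * (if c = b then 1 else 0))"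
      unfolding x_def using ks b by (intro sum.cong refl) (auto simp: nth_eq_iff_index_eq)
    then have "x (ks ! b) \<noteq> 0" using b by (simp add: sum_if_single)
    then have xpos: "0 < (\<Sum>i<n. (x i)\<^sup>2)"
      using K(1) x_outside by (intro sum_pos2[of _ "ks ! b"]) auto
    define xv where "xv = vec n x"
    \<comment> \<open>Coordinates of \<open>xv\<close> in the eigenbasis, in which the squared norms
      of \<open>M x\<close> and of \<open>x\<close> are both diagonal.\<close>
    define c where "c = P\<^sup>T *\<^sub>v xv"
    have xv: "xv \<in> carrier_vec n" and c: "c \<in> carrier_vec n" using P by (auto simp: xv_def c_def)
    have D: "diag es \<in> carrier_mat n n" using P(3) by (simp add: diag_def)
    have "(\<Sum>i<n. (app n (entry_fun n M) x i)\<^sup>2) = (M *\<^sub>v xv) \<bullet> (M *\<^sub>v xv)"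
      using M by (auto simp: xv_def scalar_prod_def atLeast0LessThan app_def entry_fun_def
          power2_eq_square intro!: sum.cong)
    also have "\<dots> = xv \<bullet> ((M\<^sup>T * M) *\<^sub>v xv)"
      using M xv transpose_vec_mult_scalar[of M n n xv "M *\<^sub>v xv"]
      by (simp add: assoc_mult_mat_vec[of _ n n _ n] comm_scalar_prod[of _ n])
    also have "(M\<^sup>T * M) *\<^sub>v xv = P *\<^sub>v (diag es *\<^sub>v c)"
      using P(1) D xv by (simp add: P(4) c_def assoc_mult_mat_vec[of _ n n _ n])
    also have "xv \<bullet> \<dots> = c \<bullet> (diag es *\<^sub>v c)"
      using P(1) D xv c unfolding c_def
      by (intro transpose_vec_mult_scalar[symmetric]) auto
    also have "\<dots> = (\<Sum>i<n. es ! i * (c $ i)\<^sup>2)"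
    proof -
      have "(diag es *\<^sub>v c) $ i = es ! i * c $ i" if "i < n" for i
      proof -
        have "(diag es *\<^sub>v c) $ i = (\<Sum>j<n. (es ! i * c $ j) * (if j = i then 1 else 0))"
          using P(3) c that
          by (auto simp: diag_def scalar_prod_def atLeast0LessThan intro!: sum.cong)
        then show ?thesis using that by (simp only: sum_if_single[OF finite_lessThan]) simp
      qed
      then show ?thesis
        using D by (simp add: scalar_prod_def atLeast0LessThan power2_eq_square mult_ac)
    qed
    finally have Mx: "(\<Sum>i<n. (app n (entry_fun n M) x i)\<^sup>2) = (\<Sum>i<n. es ! i * (c $ i)\<^sup>2)" .
    have PPT: "P * P\<^sup>T = 1\<^sub>m n"
      using mat_mult_left_right_inverse[OF _ P(1) P(2)] P(1) by simp
    have "c \<bullet> c = xv \<bullet> (P *\<^sub>v c)"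
      using P(1) xv c unfolding c_def by (intro transpose_vec_mult_scalar) auto
    also have "P *\<^sub>v c = xv"
      using P(1) xv PPT unfolding c_def by (metis assoc_mult_mat_vec one_mult_mat_vec transpose_carrier_mat)
    finally have cc: "(\<Sum>i<n. (x i)\<^sup>2) = (\<Sum>i<n. (c $ i)\<^sup>2)"
      using c by (simp add: xv_def scalar_prod_def atLeast0LessThan power2_eq_square)
    have c0: "c $ i = 0" if i: "i < n" "\<mu>\<^sup>2 \<le> es ! i" for i
    proof -
      have "i \<in> set idx" using i by (simp add: idx_def)
      then obtain a where a: "a < length idx" "idx ! a = i" by (metis in_set_conv_nth)
      have "c $ i = (\<Sum>j<n. P $$ (j,i) * x j)"
        using P(1) i by (simp add: c_def xv_def scalar_prod_def atLeast0LessThan)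
      also have "\<dots> = (\<Sum>b<?k. v $ b * P $$ (ks ! b, i))" by (rule sum_x)
      also have "\<dots> = (Q *\<^sub>v v) $ a"
        using a idx v(1) by (simp add: Q_def scalar_prod_def atLeast0LessThan mult.commute)
      also have "\<dots> = 0" using v(3) a idx by simp
      finally show ?thesis .
    qed
    have "\<exists>i<n. c $ i \<noteq> 0"
      using xpos unfolding cc by (metis (no_types, lifting) lessThan_iff less_irrefl sum.neutral zero_eq_power2)
    then obtain i where i: "i < n" "c $ i \<noteq> 0" by blast
    \<comment> \<open>Coordinates with eigenvalue at least \<open>\<mu>\<^sup>2\<close> vanish, and
      the nonzero coordinate found above makes the inequality strict.\<close>
    have "(\<Sum>i<n. es ! i * (c $ i)\<^sup>2) < (\<Sum>i<n. \<mu>\<^sup>2 * (c $ i)\<^sup>2)"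
    proof (rule sum_strict_mono_ex1)
      show "\<forall>i\<in>{..<n}. es ! i * (c $ i)\<^sup>2 \<le> \<mu>\<^sup>2 * (c $ i)\<^sup>2"
      proof
        fix j assume "j \<in> {..<n}"
        then show "es ! j * (c $ j)\<^sup>2 \<le> \<mu>\<^sup>2 * (c $ j)\<^sup>2"
          using c0[of j] by (cases "\<mu>\<^sup>2 \<le> es ! j") (auto intro: mult_right_mono)
      qed
      have "es ! i < \<mu>\<^sup>2" using i c0[OF i(1)] by linarith
      then show "\<exists>i\<in>{..<n}. es ! i * (c $ i)\<^sup>2 < \<mu>\<^sup>2 * (c $ i)\<^sup>2"
        using i by (intro bexI[of _ i] mult_strict_right_mono) auto
    qed simp
    then show False
      using form[of x, OF x_outside] unfolding Mx cc sum_distrib_left by linarith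
  qed
qed

text \<open>Expanding the squared norm of \<open>W x - \<mu> x\<close> turns a lower bound on the
  form into one on the norm of \<open>W x\<close>, in place of Cauchy-Schwarz.\<close>

lemma psd_singular_value_ge:
  assumes W: "W \<in> carrier_mat n n" and K: "K \<subseteq> {..<n}" "0 < card K" and \<mu>: "0 \<le> \<mu>"
    and form: "\<And>x. (\<And>i. i \<notin> K \<Longrightarrow> x i = 0) \<Longrightarrow>
        \<mu> * (\<Sum>i<n. (x i)\<^sup>2) \<le> qform n (entry_fun n W) x"
  shows "\<mu> \<le> singular_value W (card K)"
proof (rule singular_value_ge[OF W K \<mu>])
  fix x :: "nat \<Rightarrow> real" assume x: "\<And>i. i \<notin> K \<Longrightarrow> x i = 0"
  let ?X = "\<Sum>i<n. (x i)\<^sup>2" and ?Y = "\<Sum>i<n. (app n (entry_fun n W) x i)\<^sup>2"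
  have "0 \<le> (\<Sum>i<n. (app n (entry_fun n W) x i - \<mu> * x i)\<^sup>2)"
    by (intro sum_nonneg) auto
  also have "\<dots> = ?Y - 2 * \<mu> * qform n (entry_fun n W) x + \<mu>\<^sup>2 * ?X"
    unfolding qform_def sum_distrib_left sum_subtractf[symmetric] sum.distrib[symmetric]
    by (rule sum.cong) (auto simp: power2_eq_square algebra_simps)
  finally show "\<mu>\<^sup>2 * ?X \<le> ?Y"
    using mult_left_mono[OF form[of x, OF x] \<mu>] by (simp add: power2_eq_square)
qed

section \<open>Volumes and runs of the algorithms\<close>

lemma pivot_prod_nonneg: "psd n A \<Longrightarrow> 0 \<le> pivot_prod A ks"
  by (induction ks arbitrary: A) (auto simp: psd_diag_nonneg psd_schur)

lemma proj_volume_submatrix: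
  assumes "spsd n W" "distinct is" "set is \<subseteq> {..<n}" "length is = r"
  shows "proj_volume r (submatrix W (set is) (set is)) = pivot_prod (entry_fun n W) is"
proof -
  have "submatrix W (set is) (set is) \<in> carrier_mat r r"
    using assms dims_submatrix_subset[OF assms(3)] distinct_card[OF assms(2)]
    by (auto simp: spsd_def dim_submatrix intro!: carrier_matI)
  then show ?thesis
    using det_submatrix[OF assms(1-3)] pivot_prod_nonneg[OF spsd_psd[OF assms(1)]]
    by (simp add: proj_volume_square)
qed

text \<open>Both sides are the same determinant. Comparing two elimination orders is what relates
  the pivots before and after an exchange.\<close>

lemma pivot_prod_cong_set:
  assumes "spsd n W" "distinct is" "set is \<subseteq> {..<n}" "distinct js" "set js = set is"
  shows "pivot_prod (entry_fun n W) js = pivot_prod (entry_fun n W) is"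
  using det_submatrix[OF assms(1-3)] det_submatrix[OF assms(1,4)] assms(3,5) by simp

lemma entry_fun_residual:
  assumes "R \<in> carrier_mat n n" "i < n"
  shows "entry_fun n (R - mat n n (\<lambda>(k,l). R $$ (k,i) * inverse (R $$ (i,i)) * R $$ (i,l)))
     = schur (entry_fun n R) i"
  using assms by (intro ext) (auto simp: entry_fun_def schur_def field_simps)

text \<open>The residual has diagonal 0 at eliminated indices, so a nonzero pivot is always a new
  index and the list stays distinct.\<close>

lemma gecp_run_greedy:
  assumes "gecp_run n W t I R" "spsd n W"
  shows "R \<in> carrier_mat n n \<and> (\<exists>is. distinct is \<and> set is = I \<and> length is = t \<and> I \<subseteq> {..<n}
    \<and> greedy n (entry_fun n W) is \<and> pivot_prod (entry_fun n W) is \<noteq> 0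
    \<and> entry_fun n R = schurs (entry_fun n W) is)"
  using assms
proof (induction rule: gecp_run.induct)
  case start
  then show ?case by (auto simp: spsd_def)
next
  case (step t I R i)
  let ?A = "entry_fun n W"
  obtain "is" where R: "R \<in> carrier_mat n n" and "is": "distinct is" "set is = I" "length is = t"
    "I \<subseteq> {..<n}" "greedy n ?A is" "pivot_prod ?A is \<noteq> 0" "entry_fun n R = schurs ?A is"
    using step by auto
  have Rii: "schurs ?A is i i = R $$ (i,i)"
    using "is"(7) step.hyps(2) by (metis entry_fun_def)
  then have "i \<notin> set is"
    using schurs_eliminated[OF spsd_psd[OF step.prems], of i "is" i] step.hyps(4) by auto
  moreover have "greedy n ?A (is @ [i])"
    using "is"(5) step.hyps(2,3) unfolding greedy_append "is"(7)[symmetric]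
    by (simp add: entry_fun_def)
  moreover have "pivot_prod ?A (is @ [i]) \<noteq> 0"
    using "is"(6) Rii step.hyps(4) by (simp add: pivot_prod_append)
  ultimately have *: "distinct (is @ [i]) \<and> set (is @ [i]) = insert i I \<and> length (is @ [i]) = Suc t
    \<and> insert i I \<subseteq> {..<n} \<and> greedy n ?A (is @ [i]) \<and> pivot_prod ?A (is @ [i]) \<noteq> 0
    \<and> entry_fun n (R - mat n n (\<lambda>(k,l). R $$ (k,i) * inverse (R $$ (i,i)) * R $$ (i,l)))
       = schurs ?A (is @ [i])"
    using "is" step.hyps(2) entry_fun_residual[OF R step.hyps(2)] by auto
  show ?case
    by (intro conjI exI[of _ "is @ [i]"] minus_carrier_mat mat_carrier) (use * in simp_all)
qed

text \<open>A nonzero product keeps every pivot nonzero, so the relation never gets stuck. This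
  certifies the choices of the implementation as a legal run.\<close>

lemma greedy_gecp_run:
  assumes "spsd n W" "greedy n (entry_fun n W) is" "pivot_prod (entry_fun n W) is \<noteq> 0"
  shows "\<exists>R \<in> carrier_mat n n. gecp_run n W (length is) (set is) R
    \<and> entry_fun n R = schurs (entry_fun n W) is"
  using assms
proof (induction "is" rule: rev_induct)
  case Nil
  then show ?case using gecp_run.start by (auto simp: spsd_def)
next
  case (snoc i "is")
  let ?A = "entry_fun n W"
  obtain R where R: "R \<in> carrier_mat n n" "gecp_run n W (length is) (set is) R"
    "entry_fun n R = schurs ?A is"
    using snoc by (auto simp: greedy_append pivot_prod_append)
  have i: "i < n" "\<forall>j<n. \<bar>schurs ?A is j j\<bar> \<le> \<bar>schurs ?A is i i\<bar>" "schurs ?A is i i \<noteq> 0"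
    using snoc.prems by (auto simp: greedy_append pivot_prod_append)
  have diag: "schurs ?A is j j = R $$ (j,j)" if "j < n" for j
    using R(3) that by (metis entry_fun_def)
  have "gecp_run n W (Suc (length is)) (insert i (set is))
      (R - mat n n (\<lambda>(k,l). R $$ (k,i) * inverse (R $$ (i,i)) * R $$ (i,l)))" (is "gecp_run _ _ _ _ ?R")
    using i diag by (intro gecp_run.step[OF R(2)]) auto
  moreover have "entry_fun n ?R = schurs ?A (is @ [i])"
    using entry_fun_residual[OF R(1) i(1)] R(3) by simp
  moreover have "?R \<in> carrier_mat n n" using R(1) by auto
  ultimately show ?case by auto
qed

text \<open>The invariant of the exchange loop. Positive volume keeps the quotient in
  \<open>improving\<close> from being a division by 0.\<close>

definition admissible :: "nat \<Rightarrow> real mat \<Rightarrow> nat \<Rightarrow> nat set \<Rightarrow> bool" where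
  "admissible n W r I \<longleftrightarrow> I \<subseteq> {..<n} \<and> card I = r \<and> 0 < proj_volume r (submatrix W I I)"

definition locally_maximal :: "nat \<Rightarrow> real mat \<Rightarrow> nat \<Rightarrow> real \<Rightarrow> nat set \<Rightarrow> bool" where
  "locally_maximal n W r \<epsilon> I \<longleftrightarrow>
     (\<forall>i\<in>I. \<forall>j\<in>{..<n} - I. \<not> improving W I r \<epsilon> (insert j (I - {i})))"

lemma gecp_admissible:
  assumes "gecp n W r I" "spsd n W"
  shows "admissible n W r I"
proof -
  obtain R "is" where "distinct is" "set is = I" "length is = r" "I \<subseteq> {..<n}"
    "pivot_prod (entry_fun n W) is \<noteq> 0"
    using gecp_run_greedy assms unfolding gecp_def by blast
  then show ?thesis
    using proj_volume_submatrix[OF assms(2), of "is" r] distinct_card[of "is"]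
      pivot_prod_nonneg[OF spsd_psd[OF assms(2)], of "is"]
    by (auto simp: admissible_def)
qed

lemma card_exchange:
  assumes "finite I" "i \<in> I" "j \<notin> I"
  shows "card (insert j (I - {i})) = card I"
  using assms by (metis DiffD1 card_Suc_Diff1 card_insert_disjoint finite_Diff)

lemma improving_admissible:
  assumes "admissible n W r I" "0 < \<epsilon>" "i \<in> I" "j \<in> {..<n} - I"
    "improving W I r \<epsilon> (insert j (I - {i}))"
  shows "admissible n W r (insert j (I - {i}))"
    "(1 + \<epsilon>) * proj_volume r (submatrix W I I)
       < proj_volume r (submatrix W (insert j (I - {i})) (insert j (I - {i})))"
proof -
  let ?v = "proj_volume r (submatrix W I I)"
  have v: "0 < ?v" "finite I" using assms(1) finite_subset by (auto simp: admissible_def)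
  show *: "(1 + \<epsilon>) * ?v < proj_volume r (submatrix W (insert j (I - {i})) (insert j (I - {i})))"
    using assms(5) v by (simp add: improving_def less_divide_eq)
  have "0 < (1 + \<epsilon>) * ?v" using v assms(2) by simp
  then show "admissible n W r (insert j (I - {i}))"
    using * assms(1,3,4) v card_exchange[of I i j] unfolding admissible_def
    by (intro conjI) (auto intro: less_trans)
qed

lemma update_loop_locally_maximal:
  assumes "update_loop n W r \<epsilon> I I'" "admissible n W r I" "0 < \<epsilon>"
  shows "admissible n W r I' \<and> locally_maximal n W r \<epsilon> I'"
  using assms
proof (induction rule: update_loop.induct)
  case (stop I)
  \<comment> \<open>An exchange brings in an index outside \<open>I\<close> and never returns
    \<open>I\<close>, so stopping means that the search failed.\<close>
  then show ?case unfolding index_update_def locally_maximal_def by blast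
next
  case (continue I J I')
  then show ?case using improving_admissible(1)[of n W r I \<epsilon>] unfolding index_update_def by blast
qed

section \<open>The approximation error\<close>

text \<open>Every other index is killed by \<open>x\<close> or by a zero column, which by symmetry
  is also a zero row.\<close>

lemma qform_single:
  assumes "psd n B" "i < n" "\<And>k. k \<noteq> i \<Longrightarrow> x k = 0 \<or> (\<forall>a. B a k = 0)"
  shows "qform n B x = B i i * (x i)\<^sup>2"
proof -
  have "app n B x a = (\<Sum>b<n. (B a b * x b) * (if b = i then 1 else 0))" for a
    unfolding app_def
  proof (rule sum.cong)
    fix b
    show "B a b * x b = B a b * x b * (if b = i then 1 else 0)" using assms(3)[of b] by auto
  qed simp
  then have app: "app n B x a = B a i * x i" for a using assms(2) by (simp add: sum_if_single)
  have "qform n B x = (\<Sum>a<n. (x a * (B a i * x i)) * (if a = i then 1 else 0))"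
    unfolding qform_def app
  proof (rule sum.cong)
    fix a
    show "x a * (B a i * x i) = x a * (B a i * x i) * (if a = i then 1 else 0)"
      using assms(3)[of a] psd_sym[OF assms(1), of a i] by auto
  qed simp
  then show ?thesis using assms(2) by (simp add: sum_if_single power2_eq_square)
qed

text \<open>Column \<open>b\<close> of the residual is \<open>W\<close> applied to a vector
  \<open>w\<close>, and this product vanishes on \<open>I\<close>. By \<open>app_schurs\<close>
  elimination does not change it, and afterwards only the unit vector \<open>b\<close> in
  \<open>w\<close> contributes.\<close>

lemma CUR_residual:
  assumes "spsd n W" "distinct is" "set is = I" "I \<subseteq> {..<n}"
    and U: "U \<in> carrier_mat (card I) (card I)" "submatrix W I I * U = 1\<^sub>m (card I)"
    and ab: "a < n" "b < n"
  shows "(W - submatrix W UNIV I * U * submatrix W I UNIV) $$ (a,b)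
    = schurs (entry_fun n W) is a b"
proof -
  let ?A = "entry_fun n W" and ?r = "card I"
  have W: "W \<in> carrier_mat n n" using assms(1) by (simp add: spsd_def)
  note dims = dims_submatrix_subset[OF assms(4)]
  have pick: "pick I q \<in> I" "pick I q < n" if "q < ?r" for q
    using pick_in_set_le[OF that] assms(4) by auto
  let ?C = "submatrix W UNIV I" and ?R = "submatrix W I UNIV" and ?M = "submatrix W I I"
  have C: "?C \<in> carrier_mat n ?r" "\<And>a q. a < n \<Longrightarrow> q < ?r \<Longrightarrow> ?C $$ (a,q) = ?A a (pick I q)"
    using W dims pick by (auto simp: submatrix_def pick_UNIV entry_fun_def)
  have R: "?R \<in> carrier_mat ?r n" "\<And>b q. b < n \<Longrightarrow> q < ?r \<Longrightarrow> ?R $$ (q,b) = ?A (pick I q) b"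
    using W dims pick by (auto simp: submatrix_def pick_UNIV entry_fun_def)
  have M: "?M \<in> carrier_mat ?r ?r" "\<And>p q. p < ?r \<Longrightarrow> q < ?r \<Longrightarrow> ?M $$ (p,q) = ?A (pick I p) (pick I q)"
    using W dims pick by (auto simp: submatrix_def entry_fun_def)
  define y where "y = (\<lambda>q. (U * ?R) $$ (q,b))"
  \<comment> \<open>The unit vector \<open>b\<close> minus column \<open>b\<close> of
    \<open>U * ?R\<close> placed on the indices \<open>I\<close>.\<close>
  define w where "w = (\<lambda>c. (if c = b then 1 else 0) - (\<Sum>q<?r. y q * (if c = pick I q then 1 else 0)))"
  have app_w: "app n B w c = B c b - (\<Sum>q<?r. B c (pick I q) * y q)" for B c
  proof -
    have "app n B w c = (\<Sum>d<n. B c d * (if d = b then 1 else 0))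
        - (\<Sum>q<?r. y q * (\<Sum>d<n. B c d * (if d = pick I q then 1 else 0)))"
    proof -
      have "(\<Sum>q<?r. y q * (\<Sum>d<n. B c d * (if d = pick I q then 1 else 0)))
          = (\<Sum>d<n. B c d * (\<Sum>q<?r. y q * (if d = pick I q then 1 else 0)))"
        unfolding sum_distrib_left by (subst sum.swap) (simp only: mult_ac)
      then show ?thesis
        unfolding app_def w_def by (simp only: sum_subtractf right_diff_distrib)
    qed
    moreover have "(\<Sum>d<n. B c d * (if d = pick I q then 1 else 0)) = B c (pick I q)" if "q < ?r" for q
      using pick[OF that] by (simp add: sum_if_single)
    ultimately show ?thesis using ab by (simp add: sum_if_single mult.commute)
  qed
  have "app n ?A w k = 0" if k: "k \<in> set is" for k
  proof -
    let ?p = "card {x\<in>I. x < k}"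
    have "{x\<in>I. x < k} \<subset> I" using k assms(3) by auto
    then have p: "?p < ?r" using assms(4) by (intro psubset_card_mono) (auto intro: finite_subset)
    have pk: "pick I ?p = k" using k assms(3) by (simp add: pick_card_in_set)
    \<comment> \<open>The rows of \<open>?C\<close> indexed by \<open>I\<close> form
      \<open>?M\<close>, and \<open>?M * U = 1\<close>, so the product reproduces \<open>W\<close>
      there.\<close>
    have "?A k b = (?M * U * ?R) $$ (?p, b)"
      using U(2) R p ab pk by simp
    also have "?M * U * ?R = ?M * (U * ?R)"
      using M(1) U(1) R(1) by simp
    also have "\<dots> $$ (?p, b) = (\<Sum>q<?r. ?A k (pick I q) * y q)"
      using p ab M U R(1) pk
      by (auto simp: scalar_prod_def atLeast0LessThan y_def intro!: sum.cong)
    finally show ?thesis by (simp add: app_w)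
  qed
  then have "app n ?A w a = app n (schurs ?A is) w a" by (rule app_schurs[symmetric])
  also have "\<dots> = schurs ?A is a b"
    using pick assms(3) schurs_eliminated[OF spsd_psd[OF assms(1)]] by (simp add: app_w)
  also have "app n ?A w a = (W - ?C * (U * ?R)) $$ (a,b)"
    using C R(1) U(1) W ab
    by (auto simp: app_w scalar_prod_def atLeast0LessThan y_def entry_fun_def intro!: sum.cong)
  also have "?C * (U * ?R) = ?C * U * ?R" using C(1) R(1) U(1) by simp
  finally show ?thesis by simp
qed

lemma locally_maximal_error:
  assumes W: "spsd n W" and I: "admissible n W r I" "locally_maximal n W r \<epsilon> I"
    and \<epsilon>: "0 < \<epsilon>" and r: "r < n" and "is": "distinct is" "set is = I" and a: "a < n" and b: "b < n"
  shows "\<bar>schurs (entry_fun n W) is a b\<bar> \<le> (1 + \<epsilon>) * real (r + 1) * singular_value W (r + 1)"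
proof -
  let ?A = "entry_fun n W" and ?S = "schurs (entry_fun n W) is"
  have A: "psd n ?A" by (rule spsd_psd[OF W])
  have S: "psd n ?S" by (rule psd_schurs[OF A])
  have In: "I \<subseteq> {..<n}" "card I = r" "finite I" using I finite_subset by (auto simp: admissible_def)
  have len: "length is = r" using "is" In distinct_card by metis
  have v: "0 < pivot_prod ?A is"
    using I proj_volume_submatrix[OF W "is"(1) _ len] "is" In by (simp add: admissible_def)
  have ne: "{..<n} - I \<noteq> {}" using In r by (metis Diff_eq_empty_iff card_lessThan card_mono finite_lessThan leD In(3))
  have "finite ({..<n} - I)" by simp
  \<comment> \<open>The largest residual diagonal entry outside \<open>I\<close>; on
    \<open>I\<close> the diagonal is 0.\<close>
  then obtain j where jmax: "j \<in> {..<n} - I" "?S j j = Max ((\<lambda>k. ?S k k) ` ({..<n} - I))"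
    using obtains_MAX[OF _ ne, of "\<lambda>k. ?S k k"] by metis
  have j: "j \<in> {..<n} - I" "\<And>k. k \<in> {..<n} - I \<Longrightarrow> ?S k k \<le> ?S j j"
    using jmax by auto
  let ?s = "?S j j" and ?K = "insert j I"
  have s0: "0 \<le> ?s" by (rule psd_diag_nonneg[OF S])
  have "?S k k \<le> ?s" if "k < n" for k
    using j(2)[of k] schurs_eliminated[OF A, of k "is" k] "is"(2) s0 that by (cases "k \<in> I") auto
  then have le_s: "\<bar>?S a b\<bar> \<le> ?s" by (rule psd_abs_le[OF S _ s0])
  \<comment> \<open>The bound \<open>?s / (1 + \<epsilon>)\<close> for each coordinate, averaged
    over the \<open>r + 1\<close> coordinates in \<open>?K\<close>.\<close>
  define \<mu> where "\<mu> = ?s / ((1 + \<epsilon>) * real (r + 1))"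
  have \<mu>0: "0 \<le> \<mu>" using s0 \<epsilon> by (simp add: \<mu>_def)
  have Kcard: "card ?K = r + 1" using j In by simp
  have coord: "?s / (1 + \<epsilon>) * (x i)\<^sup>2 \<le> qform n ?A x"
    if x: "\<And>i. i \<notin> ?K \<Longrightarrow> x i = 0" and i: "i \<in> ?K" and s: "0 < ?s" for x i
  proof (cases "i = j")
    case True
    \<comment> \<open>Eliminating \<open>I\<close> leaves only the coordinate \<open>j\<close> of a
      vector supported in \<open>?K\<close>.\<close>
    have "qform n ?S x = ?s * (x j)\<^sup>2"
      using j x "is"(2) schurs_eliminated[OF A, of _ "is"] by (intro qform_single[OF S]) auto
    then have "?s * (x j)\<^sup>2 \<le> qform n ?A x" using qform_schurs_le[OF A, of "is" x] by simp
    moreover have "?s / (1 + \<epsilon>) * (x j)\<^sup>2 \<le> ?s * (x j)\<^sup>2"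
      using \<epsilon> s by (intro mult_right_mono) (auto simp: field_simps)
    ultimately show ?thesis using True by simp
  next
    case False
    then have i: "i \<in> I" using that by simp
    define ks where "ks = remove1 i is"
    have ks: "distinct ks" "set ks = I - {i}" using "is" by (auto simp: ks_def set_remove1_eq)
    let ?S' = "schurs ?A ks"
    let ?t = "?S' i i" and ?t' = "?S' j j" and ?\<tau> = "schur ?S' j i i"
    have S': "psd n ?S'" by (rule psd_schurs[OF A])
    have vt: "pivot_prod ?A ks * ?t = pivot_prod ?A is"
      using pivot_prod_cong_set[OF W "is"(1), of "ks @ [i]"] "is" In ks i
      by (simp add: pivot_prod_append insert_absorb)
    \<comment> \<open>Two elimination orders of \<open>?K\<close>: \<open>I\<close> and then
      \<open>j\<close>, or \<open>ks\<close>, then \<open>j\<close>, then \<open>i\<close>.\<close>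
    have vs: "pivot_prod ?A is * ?s = pivot_prod ?A ks * ?t' * ?\<tau>"
    proof -
      have "set (ks @ [j, i]) = set (is @ [j])" using "is"(2) ks(2) i by auto
      then have "pivot_prod ?A (ks @ [j, i]) = pivot_prod ?A (is @ [j])"
        using "is" In ks j False by (intro pivot_prod_cong_set[OF W]) auto
      then show ?thesis by (simp add: pivot_prod_append)
    qed
    have ks0: "0 < pivot_prod ?A ks" and t0: "0 < ?t"
      using v vt pivot_prod_nonneg[OF A, of ks] psd_diag_nonneg[OF S', of i]
      by (metis less_eq_real_def less_irrefl mult_zero_left mult_zero_right)+
    \<comment> \<open>Both sides are the determinant of the two by two block of \<open>?S'\<close>
      on \<open>i\<close> and \<open>j\<close>.\<close>
    have ts: "?t * ?s = ?t' * ?\<tau>"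
      using vt vs ks0 by (simp flip: vt)
    have "set (ks @ [j]) = insert j (I - {i})" using ks by auto
    then have "proj_volume r (submatrix W (insert j (I - {i})) (insert j (I - {i})))
        = pivot_prod ?A (ks @ [j])"
    proof -
      have "length ks = card (I - {i})" using ks distinct_card by metis
      then have "length (ks @ [j]) = r"
        using i In card_Suc_Diff1[of I i] by simp
      moreover have "distinct (ks @ [j])" "set (ks @ [j]) \<subseteq> {..<n}" using ks j In by auto
      ultimately show ?thesis
        using proj_volume_submatrix[OF W, of "ks @ [j]" r] \<open>set (ks @ [j]) = _\<close> by metis
    qed
    moreover have "proj_volume r (submatrix W I I) = pivot_prod ?A is"
      using proj_volume_submatrix[OF W "is"(1) _ len] "is" In by simp
    moreover have "\<not> improving W I r \<epsilon> (insert j (I - {i}))"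
      using I(2) i j by (simp add: locally_maximal_def)
    \<comment> \<open>The volume ratio of the exchange is \<open>?t' / ?t\<close>, which local
      maximality bounds.\<close>
    ultimately have "pivot_prod ?A ks * ?t' / (pivot_prod ?A ks * ?t) \<le> 1 + \<epsilon>"
      by (simp add: improving_def pivot_prod_append vt)
    then have t': "?t' \<le> (1 + \<epsilon>) * ?t" using ks0 t0 by (simp add: divide_le_eq)
    have \<tau>0: "0 \<le> ?\<tau>" by (rule psd_diag_nonneg[OF psd_schur[OF S']])
    have "?t * ?s \<le> ?t * ((1 + \<epsilon>) * ?\<tau>)"
      unfolding ts using mult_right_mono[OF t' \<tau>0] by (simp add: mult_ac)
    then have \<tau>: "?s / (1 + \<epsilon>) \<le> ?\<tau>" using t0 \<epsilon> by (simp add: divide_le_eq mult.commute)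
    have eq: "schurs ?A (ks @ [j]) = schur ?S' j" by simp
    have "qform n (schur ?S' j) x = ?\<tau> * (x i)\<^sup>2"
    proof (rule qform_single[OF psd_schur[OF S']])
      show "i < n" using i In by auto
      show "x k = 0 \<or> (\<forall>a. schur ?S' j a k = 0)" if "k \<noteq> i" for k
        using x[of k] schurs_eliminated[OF A, of k "ks @ [j]"] ks that unfolding eq[symmetric] by auto
    qed
    then have "?\<tau> * (x i)\<^sup>2 \<le> qform n ?A x" using qform_schurs_le[OF A, of "ks @ [j]" x] by simp
    then show ?thesis using mult_right_mono[OF \<tau>, of "(x i)\<^sup>2"] by simp
  qed
  have "\<mu> \<le> singular_value W (card ?K)"
  proof (rule psd_singular_value_ge[OF _ _ _ \<mu>0])
    fix x :: "nat \<Rightarrow> real" assume x: "\<And>i. i \<notin> ?K \<Longrightarrow> x i = 0"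
    show "\<mu> * (\<Sum>i<n. (x i)\<^sup>2) \<le> qform n ?A x"
    proof (cases "?s = 0")
      case True
      then show ?thesis using psd_nonneg[OF A] by (simp add: \<mu>_def)
    next
      case False
      have "(\<Sum>i<n. (x i)\<^sup>2) = (\<Sum>i\<in>?K. (x i)\<^sup>2)"
        using x j In by (intro sum.mono_neutral_right) auto
      then have "?s / (1 + \<epsilon>) * (\<Sum>i<n. (x i)\<^sup>2) = (\<Sum>i\<in>?K. ?s / (1 + \<epsilon>) * (x i)\<^sup>2)"
        by (simp add: sum_distrib_left)
      also have "\<dots> \<le> (\<Sum>i\<in>?K. qform n ?A x)"
        using False s0 by (intro sum_mono coord[OF x]) auto
      also have "\<dots> = real (r + 1) * qform n ?A x" unfolding sum_constant Kcard by simp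
      finally have "?s / (1 + \<epsilon>) * (\<Sum>i<n. (x i)\<^sup>2) / real (r + 1) \<le> qform n ?A x"
        by (intro mult_imp_div_pos_le) (simp_all only: mult.commute of_nat_0_less_iff)
      then show ?thesis unfolding \<mu>_def by simp
    qed
  qed (use W j In in \<open>auto simp: spsd_def card_gt_0_iff\<close>)
  then have "?s \<le> (1 + \<epsilon>) * real (r + 1) * singular_value W (r + 1)"
    unfolding Kcard \<mu>_def using \<epsilon> by (subst (asm) pos_divide_le_eq) (simp_all add: mult_ac)
  then show ?thesis using le_s by simp
qed

lemma main_algorithm_error:
  assumes r: "r < n" and \<epsilon>: "0 < \<epsilon>" and W: "spsd n W" and run: "main_algorithm n W r r \<epsilon> I"
  shows "\<exists>U. mat_inverse (submatrix W I I) = Some U \<and>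
     cheb_norm (W - submatrix W UNIV I * U * submatrix W I UNIV)
       \<le> (1 + \<epsilon>) * real (r + 1) * singular_value W (r + 1)"
proof -
  obtain I0 where "gecp n W r I0" "update_loop n W r \<epsilon> I0 I"
    using run by (auto simp: main_algorithm_def)
  then have I: "admissible n W r I" "locally_maximal n W r \<epsilon> I"
    using update_loop_locally_maximal gecp_admissible[OF _ W] \<epsilon> by blast+
  then have In: "I \<subseteq> {..<n}" "card I = r" "finite I" using finite_subset by (auto simp: admissible_def)
  define "is" where "is = sorted_list_of_set I"
  have "is": "distinct is" "set is = I" using In by (auto simp: is_def)
  let ?M = "submatrix W I I"
  have Wc: "W \<in> carrier_mat n n" using W by (simp add: spsd_def)
  have M: "?M \<in> carrier_mat r r"
    using Wc dims_submatrix_subset[OF In(1)] In(2) by (auto simp: dim_submatrix intro!: carrier_matI)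
  have "det ?M \<noteq> 0" using I(1) M by (auto simp: admissible_def proj_volume_square)
  then obtain U where U: "mat_inverse ?M = Some U"
    using det_non_zero_imp_unit[OF M] mat_inverse(1)[OF M] by fastforce
  then have U': "U \<in> carrier_mat r r" "?M * U = 1\<^sub>m r" using mat_inverse(2)[OF M] by auto
  let ?E = "W - submatrix W UNIV I * U * submatrix W I UNIV"
  have E: "dim_row ?E = n" "dim_col ?E = n"
    using Wc by (auto simp: dim_submatrix)
  have bound: "\<bar>?E $$ (a,b)\<bar> \<le> (1 + \<epsilon>) * real (r + 1) * singular_value W (r + 1)" if "a < n" "b < n" for a b
    using locally_maximal_error[OF W I \<epsilon> r "is" that] CUR_residual[OF W "is" In(1) _ _ that, of U] U' In(2)
    by simp
  let ?X = "{\<bar>?E $$ (a,b)\<bar> | a b. a < dim_row ?E \<and> b < dim_col ?E}"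
  have "?X = (\<lambda>(a,b). \<bar>?E $$ (a,b)\<bar>) ` ({..<n} \<times> {..<n})" unfolding E by auto
  then have "finite ?X" "?X \<noteq> {}" using r by auto
  then have "Max ?X \<le> (1 + \<epsilon>) * real (r + 1) * singular_value W (r + 1)"
    using bound E by (intro Max.boundedI) auto
  then show ?thesis using U by (auto simp: cheb_norm_def)
qed

section \<open>Correctness and cost of the implementation\<close>

lemma counted_simps [simp]:
  "fst (ret x) = x" "snd (ret x) = 0"
  "fst (bind_counted m f) = fst (f (fst m))"
  "snd (bind_counted m f) = snd m + snd (f (fst m))"
  "fst (add_c a b) = a + b" "snd (add_c a b) = 1"
  "fst (sub_c a b) = a - b" "snd (sub_c a b) = 1"
  "fst (mul_c a b) = a * b" "snd (mul_c a b) = 1"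
  "fst (div_c a b) = a / b" "snd (div_c a b) = 1"
  "fst (neg_c a) = - a" "snd (neg_c a) = 1"
  "fst (abs_c a) = \<bar>a\<bar>" "snd (abs_c a) = 1"
  "fst (less_c a b) \<longleftrightarrow> a < b" "snd (less_c a b) = 1"
  by (simp_all add: ret_def bind_counted_def add_c_def sub_c_def mul_c_def div_c_def neg_c_def
      abs_c_def less_c_def)

lemma fst_tabulate: "fst (tabulate xs f) x = (if x \<in> set xs then fst (f x) else 0)"
  by (simp add: tabulate_def)

lemma snd_tabulate: "snd (tabulate xs f) = (\<Sum>x\<leftarrow>xs. snd (f x))"
  by (simp add: tabulate_def)

lemma fst_sum_c: "fst (sum_c xs f) = (\<Sum>x\<leftarrow>xs. fst (f x))"
  by (induction xs) auto

lemma snd_sum_c: "snd (sum_c xs f) = (\<Sum>x\<leftarrow>xs. snd (f x) + 1)"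
  by (induction xs) auto

section \<open>The implementation of GECP\<close>

lemma argmax_c:
  "fst (argmax_c d b xs) \<in> set (b # xs)"
  "x \<in> set (b # xs) \<Longrightarrow> \<bar>d x\<bar> \<le> \<bar>d (fst (argmax_c d b xs))\<bar>"
  "snd (argmax_c d b xs) = 3 * length xs"
proof (induction xs arbitrary: b x)
  case (Cons y ys)
  { case 1 show ?case using Cons.IH(1)[of "if \<bar>d b\<bar> < \<bar>d y\<bar> then y else b"] by auto }
  { case 2
    let ?c = "if \<bar>d b\<bar> < \<bar>d y\<bar> then y else b"
    have "\<bar>d x\<bar> \<le> \<bar>d ?c\<bar> \<or> x \<in> set ys" using 2 by auto
    moreover have "\<bar>d z\<bar> \<le> \<bar>d (fst (argmax_c d ?c ys))\<bar>" if "z = ?c \<or> z \<in> set ys" for z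
      using Cons.IH(2)[of z ?c] that by auto
    ultimately show ?case by (auto intro: order.trans) }
  { case 3 show ?case using Cons.IH(3) by simp }
qed auto

text \<open>The stored pairs recover the residual as \<open>A\<close> minus rank-one terms. Pivots
  are prepended, hence \<open>rev is\<close>. The cost bound charges each of the \<open>t\<close>
  steps with \<open>n * (2 * t + 7)\<close>.\<close>

lemma gecp_c_spec:
  assumes W: "spsd n W" and n: "0 < n"
    and pv: "\<And>t. distinct (pv t) \<and> set (pv t) = {..<n}"
    and run: "fst (gecp_c n W pv t) = (is, d, fs)"
  shows "length is = t" "length fs = t" "greedy n (entry_fun n W) (rev is)"
    "\<And>k. k < n \<Longrightarrow> d k = schurs (entry_fun n W) (rev is) k k"
    "\<And>a k. a < n \<Longrightarrow> k < n \<Longrightarrow> schurs (entry_fun n W) (rev is) a k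
        = entry_fun n W a k - (\<Sum>(c,g)\<leftarrow>fs. c a * g k)"
    "snd (gecp_c n W pv t) \<le> n * t * (2 * t + 7)"
proof -
  let ?A = "entry_fun n W"
  have "length is = t \<and> length fs = t \<and> greedy n ?A (rev is)
    \<and> (\<forall>k<n. d k = schurs ?A (rev is) k k)
    \<and> (\<forall>a<n. \<forall>k<n. schurs ?A (rev is) a k = ?A a k - (\<Sum>(c,g)\<leftarrow>fs. c a * g k))
    \<and> snd (gecp_c n W pv t) \<le> n * t * (2 * t + 7)"
    using run
  proof (induction t arbitrary: "is" d fs)
    case 0
    then show ?case by (auto simp: entry_fun_def)
  next
    case (Suc t)
    obtain is0 d0 fs0 where st: "fst (gecp_c n W pv t) = (is0, d0, fs0)" by (metis prod_cases3)
    note IH = Suc.IH[OF st]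
    let ?R = "schurs ?A (rev is0)"
    define i where "i = fst (argmax_c d0 (hd (pv t)) (tl (pv t)))"
    have pvt: "hd (pv t) # tl (pv t) = pv t" using pv[of t] n by (cases "pv t") auto
    have len: "length (pv t) = n" using pv[of t] distinct_card[of "pv t"] by simp
    have i: "i < n" using argmax_c(1)[of d0 "hd (pv t)" "tl (pv t)"] pv[of t]
      unfolding pvt i_def by auto
    have max: "\<bar>d0 j\<bar> \<le> \<bar>d0 i\<bar>" if "j < n" for j
      using argmax_c(2)[of j "hd (pv t)" "tl (pv t)" d0] pv[of t] that unfolding pvt i_def by auto
    have R: "psd n ?R" by (rule psd_schurs[OF spsd_psd[OF W]])
    define c where "c = fst (tabulate [0..<n] (\<lambda>k. do {
            s \<leftarrow> sum_c fs0 (\<lambda>(c', g'). mul_c (c' k) (g' i));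
            sub_c (W $$ (k,i)) s }))"
    define g where "g = fst (tabulate [0..<n] (\<lambda>k. div_c (c k) (d0 i)))"
    have c: "c k = ?R k i" if "k < n" for k
    proof -
      have "?R k i = ?A k i - (\<Sum>x\<leftarrow>fs0. fst x k * snd x i)"
        using IH i that unfolding case_prod_beta by blast
      then show ?thesis
        using that i by (simp add: c_def fst_tabulate fst_sum_c entry_fun_def case_prod_beta)
    qed
    \<comment> \<open>\<open>g\<close> is computed as a scaled column; by symmetry it is the scaled
      pivot row that \<open>schur\<close> needs.\<close>
    have g: "g k = ?R i k / ?R i i" if "k < n" for k
      using that c[OF that] IH i psd_sym[OF R, of k i] by (simp add: g_def fst_tabulate)
    have eqs: "is = i # is0" "fs = (c, g) # fs0"
      "d = fst (tabulate [0..<n] (\<lambda>k. do { q \<leftarrow> mul_c (c k) (g k); sub_c (d0 k) q }))"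
      using Suc.prems by (auto simp: st c_def g_def i_def case_prod_beta Let_def)
    \<comment> \<open>The added terms are the pivot search, the pivot column, its division and the
      update of the diagonal.\<close>
    have "snd (gecp_c n W pv (Suc t)) = snd (gecp_c n W pv t) + 3 * (n - 1) + n * (2 * t + 1) + n + 2 * n"
    proof -
      have "snd (argmax_c d0 (hd (pv t)) (tl (pv t))) = 3 * (n - 1)"
        using argmax_c(3)[of d0 "hd (pv t)" "tl (pv t)"] len by simp
      moreover have "(\<Sum>x\<leftarrow>fs0. Suc (snd (case x of (c', g') \<Rightarrow> mul_c (c' k) (g' l)))) = 2 * t" for k l
        using IH by (simp add: case_prod_beta sum_list_triv)
      ultimately show ?thesis
        by (simp add: st snd_tabulate snd_sum_c sum_list_triv algebra_simps)
    qed
    also have "\<dots> \<le> n * t * (2 * t + 7) + n * (2 * t + 7)"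
    proof -
      have "snd (gecp_c n W pv t) \<le> n * t * (2 * t + 7)" using IH by blast
      moreover have "3 * (n - 1) \<le> 3 * n" by simp
      moreover have "n * (2 * t + 7) = 3 * n + n * (2 * t + 1) + n + 2 * n" by (simp add: algebra_simps)
      ultimately show ?thesis by linarith
    qed
    also have "\<dots> \<le> n * Suc t * (2 * Suc t + 7)" by (simp add: algebra_simps)
    finally have cost: "snd (gecp_c n W pv (Suc t)) \<le> n * Suc t * (2 * Suc t + 7)" .
    have "greedy n ?A (rev is)"
      using IH i max by (auto simp: eqs greedy_append)
    moreover have "schurs ?A (rev is) a k = ?A a k - (\<Sum>(c,g)\<leftarrow>fs. c a * g k)" if "a < n" "k < n" for a k
    proof -
      have "?R a k = ?A a k - (\<Sum>(c,g)\<leftarrow>fs0. c a * g k)" using IH that by blast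
      then show ?thesis using c[OF that(1)] g[OF that(2)] by (simp add: eqs schur_def)
    qed
    moreover have "d k = schurs ?A (rev is) k k" if "k < n" for k
    proof -
      have "d0 k = ?R k k" using IH that by blast
      then show ?thesis using c[OF that] g[OF that] that
        by (simp add: eqs fst_tabulate schur_def[of ?R])
    qed
    ultimately show ?case using IH cost by (simp add: eqs)
  qed
  then show "length is = t" "length fs = t" "greedy n ?A (rev is)"
    "\<And>k. k < n \<Longrightarrow> d k = schurs ?A (rev is) k k"
    "\<And>a k. a < n \<Longrightarrow> k < n \<Longrightarrow> schurs ?A (rev is) a k = ?A a k - (\<Sum>(c,g)\<leftarrow>fs. c a * g k)"
    "snd (gecp_c n W pv t) \<le> n * t * (2 * t + 7)"
    by blast+
qed

section \<open>Gauss-Jordan exchange and inversion\<close>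

definition represents :: "nat set \<Rightarrow> (nat \<times> nat \<Rightarrow> real) \<Rightarrow> (nat \<Rightarrow> real) \<Rightarrow> (nat \<Rightarrow> real) \<Rightarrow> bool" where
  "represents I B y x \<longleftrightarrow> (\<forall>i\<in>I. y i = (\<Sum>j\<in>I. B (i,j) * x j))"

text \<open>Row \<open>k\<close> is solved for \<open>x k\<close> and substituted into the other
  rows, giving an equivalent system. A table is described by the relation it imposes, since midway
  it is neither the matrix nor its inverse.\<close>

lemma represents_exchange:
  assumes "finite I" "k \<in> I" "B (k,k) \<noteq> 0"
    and "B' (k,k) = 1 / B (k,k)"
    and "\<And>j. j \<in> I \<Longrightarrow> j \<noteq> k \<Longrightarrow> B' (k,j) = - (B (k,j) / B (k,k))"
    and "\<And>i. i \<in> I \<Longrightarrow> i \<noteq> k \<Longrightarrow> B' (i,k) = B (i,k) / B (k,k)"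
    and "\<And>i j. i \<in> I \<Longrightarrow> j \<in> I \<Longrightarrow> i \<noteq> k \<Longrightarrow> j \<noteq> k \<Longrightarrow>
      B' (i,j) = B (i,j) - B (i,k) * B (k,j) / B (k,k)"
  shows "represents I B' (y(k := x k)) (x(k := y k)) \<longleftrightarrow> represents I B y x"
proof -
  let ?p = "B (k,k)"
  define s where "s = (\<lambda>i. \<Sum>j\<in>I - {k}. B (i,j) * x j)"
  have split: "(\<Sum>j\<in>I. f j) = f k + (\<Sum>j\<in>I - {k}. f j)" for f :: "nat \<Rightarrow> real"
    using assms(1,2) by (rule sum.remove)
  have row_k: "(\<Sum>j\<in>I. B' (k,j) * (x(k := y k)) j) = (y k - s k) / ?p"
  proof -
    have "(\<Sum>j\<in>I - {k}. B' (k,j) * (x(k := y k)) j) = - s k / ?p"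
      unfolding s_def sum_negf[symmetric] sum_divide_distrib
      by (rule sum.cong) (auto simp: assms(5))
    then show ?thesis unfolding split by (simp add: assms(4) diff_divide_distrib)
  qed
  have row: "(\<Sum>j\<in>I. B' (i,j) * (x(k := y k)) j) = s i + B (i,k) * ((y k - s k) / ?p)"
    if "i \<in> I" "i \<noteq> k" for i
  proof -
    have "(\<Sum>j\<in>I - {k}. B' (i,j) * (x(k := y k)) j) = s i - B (i,k) * s k / ?p"
      unfolding s_def sum_distrib_left sum_divide_distrib sum_subtractf[symmetric]
      by (rule sum.cong) (auto simp: assms(7) that algebra_simps)
    then show ?thesis unfolding split using that
      by (simp add: assms(6) diff_divide_distrib right_diff_distrib)
  qed
  have "represents I B' (y(k := x k)) (x(k := y k)) \<longleftrightarrow>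
      x k = (y k - s k) / ?p \<and> (\<forall>i\<in>I - {k}. y i = s i + B (i,k) * ((y k - s k) / ?p))"
    unfolding represents_def using row row_k assms(2) by auto
  also have "\<dots> \<longleftrightarrow> y k = ?p * x k + s k \<and> (\<forall>i\<in>I - {k}. y i = B (i,k) * x k + s i)"
  proof -
    have "x k = (y k - s k) / ?p \<longleftrightarrow> y k = ?p * x k + s k"
      using assms(3) by (auto simp: field_simps)
    then show ?thesis by (metis add.commute)
  qed
  also have "\<dots> \<longleftrightarrow> represents I B y x"
    unfolding represents_def split s_def using assms(2) by auto
  finally show ?thesis .
qed

text \<open>On the indices still to come the table is a Schur complement, so its pivots are the
  nonzero factors of \<open>pivot_prod\<close>. The other entries enter only through the represented
  relation.\<close>

lemma exchange_c_spec:
  assumes "psd n S" "distinct ks" "set ks \<subseteq> set is"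
    and "\<And>i j. i \<in> set ks \<Longrightarrow> j \<in> set ks \<Longrightarrow> B (i,j) = S i j"
    and "pivot_prod S ks \<noteq> 0"
  shows "snd (fst (exchange_c is ks B v)) = v * pivot_prod S ks
    \<and> (\<forall>y x. represents (set is) (fst (fst (exchange_c is ks B v)))
            (\<lambda>i. if i \<in> set ks then x i else y i) (\<lambda>i. if i \<in> set ks then y i else x i)
          \<longleftrightarrow> represents (set is) B y x)"
  using assms
proof (induction ks arbitrary: S B v)
  case (Cons k ks)
  define B' where "B' = fst (tabulate (List.product is is) (\<lambda>(i,j).
        if i = k \<and> j = k then div_c 1 (B (k,k))
        else if i = k then do { q \<leftarrow> div_c (B (k,j)) (B (k,k)); neg_c q }
        else if j = k then div_c (B (i,k)) (B (k,k))
        else do { p \<leftarrow> mul_c (B (i,k)) (B (k,j)); q \<leftarrow> div_c p (B (k,k)); sub_c (B (i,j)) q }))"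
  have run: "fst (exchange_c is (k # ks) B v) = fst (exchange_c is ks B' (v * B (k,k)))"
    by (simp add: B'_def)
  have Bk: "B (k,k) = S k k" "S k k \<noteq> 0" using Cons.prems(4,5) by auto
  have B': "B' (i,j) = (if i = k \<and> j = k then 1 / B (k,k) else if i = k then - (B (k,j) / B (k,k))
      else if j = k then B (i,k) / B (k,k) else B (i,j) - B (i,k) * B (k,j) / B (k,k))"
    if "i \<in> set is" "j \<in> set is" for i j
    using that by (simp add: B'_def fst_tabulate)
  let ?C = "fst (exchange_c is ks B' (v * B (k,k)))"
  have IH: "snd ?C = v * B (k,k) * pivot_prod (schur S k) ks
    \<and> (\<forall>y x. represents (set is) (fst ?C)
            (\<lambda>i. if i \<in> set ks then x i else y i) (\<lambda>i. if i \<in> set ks then y i else x i)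
          \<longleftrightarrow> represents (set is) B' y x)"
  proof (rule Cons.IH[OF psd_schur[OF Cons.prems(1)]])
    show "B' (i,j) = schur S k i j" if "i \<in> set ks" "j \<in> set ks" for i j
    proof -
      have "i \<in> set is" "j \<in> set is" "i \<noteq> k" "j \<noteq> k" using that Cons.prems(2,3) by auto
      then have "B' (i,j) = B (i,j) - B (i,k) * B (k,j) / B (k,k)" using B'[of i j] by simp
      then show ?thesis using that Cons.prems(4) by (simp add: schur_def)
    qed
  qed (use Cons.prems in auto)
  have "represents (set is) (fst ?C)
      (\<lambda>i. if i \<in> set (k # ks) then x i else y i) (\<lambda>i. if i \<in> set (k # ks) then y i else x i)
      \<longleftrightarrow> represents (set is) B y x" for y x
  proof -
    let ?y = "y(k := x k)" and ?x = "x(k := y k)"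
    \<comment> \<open>As \<open>k\<close> is not in \<open>ks\<close>, exchanging \<open>k\<close>
      first and \<open>ks\<close> afterwards is one simultaneous exchange.\<close>
    have "(\<lambda>i. if i \<in> set (k # ks) then x i else y i) = (\<lambda>i. if i \<in> set ks then ?x i else ?y i)"
      "(\<lambda>i. if i \<in> set (k # ks) then y i else x i) = (\<lambda>i. if i \<in> set ks then ?y i else ?x i)"
      using Cons.prems(2) by auto
    then have "represents (set is) (fst ?C)
        (\<lambda>i. if i \<in> set (k # ks) then x i else y i) (\<lambda>i. if i \<in> set (k # ks) then y i else x i)
        \<longleftrightarrow> represents (set is) B' ?y ?x"
      by (simp only: conjunct2[OF IH, rule_format])
    also have "\<dots> \<longleftrightarrow> represents (set is) B y x"
      by (rule represents_exchange) (use Cons.prems(3) Bk B' in auto)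
    finally show ?thesis .
  qed
  moreover have "snd ?C = v * pivot_prod S (k # ks)" using IH Bk by simp
  ultimately show ?case unfolding run by blast
qed simp

lemma exchange_c_cost:
  "snd (exchange_c is ks B v) \<le> length ks * (1 + 3 * (length is)\<^sup>2)"
proof (induction ks arbitrary: B v)
  case (Cons k ks)
  let ?f = "\<lambda>(i,j). if i = k \<and> j = k then div_c 1 (B (k,k))
        else if i = k then do { q \<leftarrow> div_c (B (k,j)) (B (k,k)); neg_c q }
        else if j = k then div_c (B (i,k)) (B (k,k))
        else do { p \<leftarrow> mul_c (B (i,k)) (B (k,j)); q \<leftarrow> div_c p (B (k,k)); sub_c (B (i,j)) q }"
  have "snd (tabulate (List.product is is) ?f) \<le> (\<Sum>p\<leftarrow>List.product is is. 3)"
    unfolding snd_tabulate by (rule sum_list_mono) auto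
  then have "snd (tabulate (List.product is is) ?f) \<le> 3 * (length is)\<^sup>2"
    by (simp add: sum_list_triv power2_eq_square)
  moreover have "snd (exchange_c is (k # ks) B v) = 1 + snd (tabulate (List.product is is) ?f)
      + snd (exchange_c is ks (fst (tabulate (List.product is is) ?f)) (v * B (k,k)))"
    by simp
  ultimately show ?case
    using Cons.IH[of "fst (tabulate (List.product is is) ?f)" "v * B (k,k)"] by simp
qed simp

text \<open>Let \<open>?S\<close> remain after eliminating all of \<open>is\<close> but
  \<open>i\<close>. Then \<open>M (i,i)\<close> is \<open>1 / ?S i i\<close> and \<open>y i\<close>
  is \<open>?S i j / ?S i i\<close>, so the formula collapses to the product of the eliminated
  pivots times \<open>?S j j\<close>.\<close>

lemma swapped_volume_c_spec:
  assumes W: "spsd n W" and "is": "distinct is" "set is \<subseteq> {..<n}"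
    and v: "v = pivot_prod (entry_fun n W) is" "v \<noteq> 0"
    and M: "\<And>y x. represents (set is) M x y \<longleftrightarrow> represents (set is) (\<lambda>p. W $$ p) y x"
    and i: "i \<in> set is" and j: "j < n" "j \<notin> set is"
  shows "fst (swapped_volume_c W is M v i j) = pivot_prod (entry_fun n W) (remove1 i is @ [j])"
proof -
  let ?A = "entry_fun n W" and ?I = "set is"
  have A: "psd n ?A" by (rule spsd_psd[OF W])
  have WA: "W $$ (a,b) = ?A a b" if "a < n" "b < n" for a b using that by (simp add: entry_fun_def)
  define ks where "ks = remove1 i is"
  have ks: "set ks = ?I - {i}" "distinct ks" using "is" by (auto simp: ks_def set_remove1_eq)
  let ?S = "schurs ?A ks"
  have S0: "?S a c = 0" if "c \<in> ?I - {i}" for a c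
    using schurs_eliminated[OF A, of c ks a] that ks by simp
  have vt: "v = pivot_prod ?A ks * ?S i i"
  proof -
    have "pivot_prod ?A (ks @ [i]) = pivot_prod ?A is"
      using ks i "is" by (intro pivot_prod_cong_set[OF W]) auto
    then show ?thesis by (simp add: v pivot_prod_append)
  qed
  then have t: "?S i i \<noteq> 0" using v by auto
  define y where "y = (\<lambda>k. if k \<in> ?I then \<Sum>l\<in>?I. M (k,l) * W $$ (l,j) else 0)"
  have sums: "(\<Sum>x\<leftarrow>is. f x) = (\<Sum>x\<in>?I. f x)" for f :: "nat \<Rightarrow> real"
    by (rule sum_list_distinct_conv_sum_set[OF "is"(1)])
  have tab: "fst (tabulate is (\<lambda>k. sum_c is (\<lambda>l. mul_c (M (k,l)) (W $$ (l,j))))) = y"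
    by (intro ext) (simp add: y_def fst_tabulate fst_sum_c sums)
  have val: "fst (swapped_volume_c W is M v i j)
      = v * (M (i,i) * (W $$ (j,j) - (\<Sum>k\<in>?I. W $$ (k,j) * y k)) + y i * y i)"
    unfolding swapped_volume_c_def by (simp add: tab fst_sum_c sums)
  have app_sub: "app n B (\<lambda>c. if c \<in> ?I then f c else 0) a = (\<Sum>c\<in>?I. B a c * f c)" for B f a
  proof -
    have "(\<Sum>c<n. B a c * (if c \<in> ?I then f c else 0)) = (\<Sum>c\<in>?I. B a c * (if c \<in> ?I then f c else 0))"
      using "is"(2) by (intro sum.mono_neutral_right) auto
    then show ?thesis unfolding app_def by (simp cong: sum.cong)
  qed
  have keep_i: "(\<Sum>c\<in>?I. ?S a c * f c) = ?S a i * f i" for a f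
    using i S0 by (subst sum.remove[of _ i]) auto
  \<comment> \<open>On \<open>?I\<close>, column \<open>i\<close> of \<open>M\<close> is mapped to
    the unit vector \<open>i\<close>; eliminating the other indices does not disturb this.\<close>
  have Mii: "?S i i * M (i,i) = 1"
  proof -
    let ?e = "\<lambda>k. if k = i then 1 else 0 :: real"
    have "represents ?I M (\<lambda>k. M (k,i)) ?e"
      using i by (auto simp: represents_def sum_if_single)
    then have "represents ?I (\<lambda>p. W $$ p) ?e (\<lambda>k. M (k,i))" by (rule M[THEN iffD1])
    then have "?e k = (\<Sum>l\<in>?I. W $$ (k,l) * M (l,i))" if "k \<in> ?I" for k
      using that unfolding represents_def by blast
    moreover have "(\<Sum>l\<in>?I. W $$ (k,l) * M (l,i)) = (\<Sum>l\<in>?I. ?A k l * M (l,i))" if "k \<in> ?I" for k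
      using that "is"(2) WA by (intro sum.cong) auto
    ultimately have "?e k = (\<Sum>l\<in>?I. ?A k l * M (l,i))" if "k \<in> ?I" for k
      using that by simp
    then have *: "app n ?A (\<lambda>c. if c \<in> ?I then M (c,i) else 0) k = ?e k" if "k \<in> ?I" for k
      unfolding app_sub using that by auto
    then have "app n ?S (\<lambda>c. if c \<in> ?I then M (c,i) else 0) i = 1"
      using ks i by (subst app_schurs) auto
    then show ?thesis unfolding app_sub keep_i .
  qed
  \<comment> \<open>The unit vector \<open>j\<close> minus \<open>y\<close>, which \<open>?A\<close>
    annihilates on the rows \<open>?I\<close>. Comparing rows \<open>i\<close> and \<open>j\<close>
    before and after elimination gives \<open>yi\<close> and \<open>s\<close>.\<close>
  let ?x = "\<lambda>c. (if c \<in> ?I then - y c else 0) + (if c = j then 1 else 0)"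
  have app_x: "app n B ?x a = B a j - (\<Sum>c\<in>?I. B a c * y c)" for B a
    unfolding app_add_single[OF j(1)] app_sub by (simp add: sum_negf)
  have x0: "app n ?A ?x k = 0" if "k \<in> ?I" for k
  proof -
    have "represents ?I M y (\<lambda>l. W $$ (l,j))" by (simp add: represents_def y_def)
    then have "represents ?I (\<lambda>p. W $$ p) (\<lambda>l. W $$ (l,j)) y" by (rule M[THEN iffD1])
    then have "W $$ (k,j) = (\<Sum>c\<in>?I. W $$ (k,c) * y c)" using that unfolding represents_def by blast
    moreover have "(\<Sum>c\<in>?I. W $$ (k,c) * y c) = (\<Sum>c\<in>?I. ?A k c * y c)"
      using that "is"(2) WA by (intro sum.cong) auto
    ultimately show ?thesis unfolding app_x using that "is"(2) WA j by auto
  qed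
  have app_S: "app n ?S ?x a = app n ?A ?x a" for a
    using ks x0 by (intro app_schurs) auto
  have yi: "?S i j = ?S i i * y i"
    using app_S[of i] x0[OF i] unfolding app_x keep_i by simp
  have "(\<Sum>k\<in>?I. W $$ (k,j) * y k) = (\<Sum>k\<in>?I. ?A j k * y k)"
  proof (rule sum.cong)
    fix k assume "k \<in> ?I"
    then show "W $$ (k,j) * y k = ?A j k * y k"
      using "is"(2) WA[of k j] j psd_sym[OF A, of j k] by auto
  qed simp
  then have s: "W $$ (j,j) - (\<Sum>k\<in>?I. W $$ (k,j) * y k) = ?S j j - ?S i i * y i * y i"
    using app_S[of j] yi psd_sym[OF psd_schurs[OF A], of ks j i] WA[of j j] j
    unfolding app_x keep_i by simp
  have "fst (swapped_volume_c W is M v i j)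
      = v * (M (i,i) * (?S j j - ?S i i * y i * y i) + y i * y i)"
    unfolding val s ..
  also have "\<dots> = pivot_prod ?A ks * (?S i i * M (i,i) * (?S j j - ?S i i * y i * y i) + ?S i i * y i * y i)"
    by (simp add: vt algebra_simps)
  also have "\<dots> = pivot_prod ?A (ks @ [j])" unfolding Mii by (simp add: pivot_prod_append)
  finally show ?thesis by (simp add: ks_def)
qed

lemma swapped_volume_c_cost:
  "snd (swapped_volume_c A is M v i j) = 2 * (length is)\<^sup>2 + 2 * length is + 5"
  unfolding swapped_volume_c_def
  by (simp add: snd_tabulate snd_sum_c sum_list_triv power2_eq_square)

lemma search_c_spec:
  "case fst (search_c A is M v \<theta> ps) of
     None \<Rightarrow> \<forall>(i,j)\<in>set ps. \<not> \<theta> < fst (swapped_volume_c A is M v i j) / v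
   | Some (i,j) \<Rightarrow> (i,j) \<in> set ps \<and> \<theta> < fst (swapped_volume_c A is M v i j) / v"
proof (induction ps)
  case (Cons p ps)
  then show ?case by (cases p) (auto split: option.splits)
qed simp

lemma search_c_cost:
  "snd (search_c A is M v \<theta> ps) \<le> length ps * (2 * (length is)\<^sup>2 + 2 * length is + 7)"
proof (induction ps)
  case (Cons p ps)
  then show ?case by (cases p) (auto simp: swapped_volume_c_cost)
qed simp

lemma index_update_c_spec:
  assumes W: "spsd n W" and "is": "distinct is" "set is \<subseteq> {..<n}" "length is = r"
    and r: "0 < r" and v: "0 < pivot_prod (entry_fun n W) is"
    and ps: "distinct ps" "set ps = set is \<times> ({..<n} - set is)"
  shows "case fst (index_update_c W is ps \<epsilon>) of
     None \<Rightarrow> locally_maximal n W r \<epsilon> (set is)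
   | Some js \<Rightarrow> (\<exists>i\<in>set is. \<exists>j\<in>{..<n} - set is. js = j # remove1 i is
        \<and> improving W (set is) r \<epsilon> (insert j (set is - {i})))"
    "snd (index_update_c W is ps \<epsilon>) \<le> 16 * n * r ^ 3"
proof -
  let ?A = "entry_fun n W" and ?I = "set is"
  obtain M v0 where ex: "fst (exchange_c is is (\<lambda>p. W $$ p) 1) = (M, v0)" by (metis prod.exhaust)
  have entries: "W $$ (i,j) = ?A i j" if "i \<in> ?I" "j \<in> ?I" for i j
    using that "is"(2) by (auto simp: entry_fun_def)
  have "v0 = 1 * pivot_prod ?A is \<and> (\<forall>y x. represents ?I M
            (\<lambda>i. if i \<in> ?I then x i else y i) (\<lambda>i. if i \<in> ?I then y i else x i)
          \<longleftrightarrow> represents ?I (\<lambda>p. W $$ p) y x)"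
    using exchange_c_spec[OF spsd_psd[OF W] "is"(1) subset_refl, of "\<lambda>p. W $$ p" 1, OF entries] v
    unfolding ex by simp
  then have v0: "v0 = pivot_prod ?A is"
    and M0: "represents ?I M (\<lambda>i. if i \<in> ?I then x i else y i) (\<lambda>i. if i \<in> ?I then y i else x i)
          \<longleftrightarrow> represents ?I (\<lambda>p. W $$ p) y x" for x y
    by auto
  \<comment> \<open>\<open>represents\<close> looks only at \<open>?I\<close>, where the roles of
    \<open>x\<close> and \<open>y\<close> have all been exchanged.\<close>
  have M: "represents ?I M x y \<longleftrightarrow> represents ?I (\<lambda>p. W $$ p) y x" for x y
    using M0[of x y] by (simp add: represents_def)
  have improving: "1 + \<epsilon> < fst (swapped_volume_c W is M v0 i j) / v0
      \<longleftrightarrow> improving W ?I r \<epsilon> (insert j (?I - {i}))" if "i \<in> ?I" "j \<in> {..<n} - ?I" for i j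
  proof -
    have "set (remove1 i is @ [j]) = insert j (?I - {i})" using "is"(1) by (auto simp: set_remove1_eq)
    moreover have "length (remove1 i is @ [j]) = r"
      using that "is"(3) length_pos_if_in_set[of i "is"] by (simp add: length_remove1)
    ultimately have "proj_volume r (submatrix W (insert j (?I - {i})) (insert j (?I - {i})))
        = pivot_prod ?A (remove1 i is @ [j])"
      using proj_volume_submatrix[OF W, of "remove1 i is @ [j]" r] "is" that
      by (force simp: set_remove1_eq)
    moreover have "proj_volume r (submatrix W ?I ?I) = v0"
      using proj_volume_submatrix[OF W "is"] v0 by simp
    moreover have "fst (swapped_volume_c W is M v0 i j) = pivot_prod ?A (remove1 i is @ [j])"
      using swapped_volume_c_spec[OF W "is"(1,2) v0 _ M that(1)] that v v0 by auto
    ultimately show ?thesis by (simp add: improving_def)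
  qed
  have fst: "fst (index_update_c W is ps \<epsilon>)
      = map_option (\<lambda>(i,j). j # remove1 i is) (fst (search_c W is M v0 (1 + \<epsilon>) ps))"
    unfolding index_update_c_def by (simp add: ex)
  show "case fst (index_update_c W is ps \<epsilon>) of
     None \<Rightarrow> locally_maximal n W r \<epsilon> ?I
   | Some js \<Rightarrow> (\<exists>i\<in>?I. \<exists>j\<in>{..<n} - ?I. js = j # remove1 i is
        \<and> improving W ?I r \<epsilon> (insert j (?I - {i})))"
    using search_c_spec[of ps "1 + \<epsilon>" W "is" M v0] improving
    unfolding fst ps(2) locally_maximal_def by (auto split: option.splits)
  have "length ps = card (?I \<times> ({..<n} - ?I))" using ps distinct_card by metis
  also have "\<dots> \<le> r * n"
    using "is" distinct_card[OF "is"(1)] card_mono[of "{..<n}" "{..<n} - ?I"] by (simp add: card_cartesian_product)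
  finally have len: "length ps \<le> r * n" .
  show "snd (index_update_c W is ps \<epsilon>) \<le> 16 * n * r ^ 3"
  proof -
    have "snd (index_update_c W is ps \<epsilon>)
        = snd (exchange_c is is (\<lambda>p. W $$ p) 1) + 1 + snd (search_c W is M v0 (1 + \<epsilon>) ps)"
      unfolding index_update_c_def by (simp add: ex)
    also have "\<dots> \<le> r * (1 + 3 * r\<^sup>2) + 1 + r * n * (2 * r\<^sup>2 + 2 * r + 7)"
      using exchange_c_cost[of "is" "is" "\<lambda>p. W $$ p" 1, unfolded "is"(3)]
        search_c_cost[of W "is" M v0 "1 + \<epsilon>" ps, unfolded "is"(3)]
        mult_le_mono1[OF len, of "2 * r\<^sup>2 + 2 * r + 7"]
      by (intro add_mono order.refl) (blast intro: order.trans)+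
    \<comment> \<open>As \<open>r\<close> is at least 1, \<open>r + 1\<close> is at most
      \<open>2 * r ^ 3\<close> and \<open>2 * r + 7\<close> at most
      \<open>9 * r\<^sup>2\<close>.\<close>
    also have "\<dots> \<le> 5 * r ^ 3 + r * n * (11 * r\<^sup>2)"
    proof -
      have "r \<le> r\<^sup>2" "1 \<le> r\<^sup>2" "r \<le> r ^ 3" "1 \<le> r ^ 3"
        using r by (auto simp: self_le_power)
      moreover have "r * (1 + 3 * r\<^sup>2) + 1 = r + 1 + 3 * r ^ 3"
        by (simp add: power2_eq_square power3_eq_cube algebra_simps)
      ultimately show ?thesis by (intro add_mono mult_le_mono) linarith+
    qed
    also have "\<dots> \<le> 16 * n * r ^ 3"
    proof -
      have "set is \<noteq> {}" using r "is"(3) by auto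
      then have "1 \<le> n" using "is"(2) by (cases "n = 0") auto
      then have "5 * r ^ 3 \<le> 5 * n * r ^ 3" by simp
      then show ?thesis by (simp add: power2_eq_square power3_eq_cube algebra_simps)
    qed
    finally show ?thesis .
  qed
qed

section \<open>Number of exchanges and total cost\<close>

lemma fact_Suc_le_power: "(fact (Suc r) :: real) \<le> real (r + 1) ^ r"
proof (induction r)
  case (Suc r)
  have "(fact (Suc (Suc r)) :: real) = real (r + 2) * fact (Suc r)" by simp
  also have "\<dots> \<le> real (r + 2) * real (r + 2) ^ r"
    using Suc power_mono[of "real (r + 1)" "real (r + 2)" r] by (intro mult_left_mono) auto
  finally show ?case by simp
qed simp

definition growth_bound :: "nat \<Rightarrow> real" where
  "growth_bound r = fact r * fact (Suc r)"

text \<open>The 4 comes from two factorials, each at most \<open>(r + 1) ^ r\<close>, and from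
  \<open>r + 1\<close> being at most the square of \<open>max 2 r\<close>. The maximum keeps the
  logarithm at least 1 for \<open>r = 1\<close>.\<close>

lemma growth_bound_le:
  assumes "0 < r"
  shows "growth_bound r \<le> exp (4 * real r * log 2 (real (max 2 r)))"
proof -
  let ?m = "real (max 2 r)"
  have "growth_bound r \<le> fact (Suc r) * fact (Suc r)"
    unfolding growth_bound_def by (intro mult_right_mono fact_mono) auto
  also have "\<dots> \<le> real (r + 1) ^ r * real (r + 1) ^ r"
    by (intro mult_mono fact_Suc_le_power) auto
  also have "\<dots> = (real (r + 1) ^ 2) ^ r"
    by (simp add: power_mult_distrib[symmetric] power2_eq_square)
  also have "\<dots> \<le> ((?m ^ 2) ^ 2) ^ r"
  proof (intro power_mono)
    have "r + 1 \<le> 2 * max 2 r" by simp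
    also have "\<dots> \<le> (max 2 r)\<^sup>2" unfolding power2_eq_square by (intro mult_right_mono) auto
    finally have "r + 1 \<le> (max 2 r)\<^sup>2" .
    then show "real (r + 1) \<le> ?m ^ 2" by (metis of_nat_mono of_nat_power)
  qed auto
  also have "\<dots> = exp (4 * real r * ln ?m)"
  proof -
    have "((?m ^ 2) ^ 2) ^ r = ?m ^ (4 * r)" by (simp add: power_mult[symmetric])
    also have "\<dots> = exp (real (4 * r) * ln ?m)" by (subst exp_of_nat_mult) simp
    finally show ?thesis by simp
  qed
  also have "\<dots> \<le> exp (4 * real r * log 2 ?m)"
  proof -
    have "ln (2::real) \<le> 1" using ln_le_minus_one[of 2] by simp
    then have "ln ?m \<le> log 2 ?m"
      by (simp add: log_def le_divide_eq mult_left_le)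
    then show ?thesis by (simp add: mult_left_mono)
  qed
  finally show ?thesis .
qed

text \<open>Principal minors are a special case of \<open>minor_le_greedy\<close>, so GECP starts
  within the factor \<open>growth_bound r\<close> of every volume that exchanges can reach.\<close>

lemma greedy_pivot_prod_max:
  assumes W: "spsd n W" and greedy: "greedy n (entry_fun n W) is" "length is = r"
    and js: "length js = r"
  shows "pivot_prod (entry_fun n W) js \<le> growth_bound r * pivot_prod (entry_fun n W) is"
proof -
  have A: "psd n (entry_fun n W)" by (rule spsd_psd[OF W])
  show ?thesis
    using minor_le_greedy[OF A greedy, of "(!) js" "(!) js"] minor_diag[OF A, of js] js
    by (simp add: growth_bound_def)
qed

definition main_step :: "real mat \<Rightarrow> (nat list \<Rightarrow> (nat \<times> nat) list) \<Rightarrow> real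
    \<Rightarrow> bool \<times> nat list \<times> nat \<Rightarrow> bool \<times> nat list \<times> nat" where
  "main_step W po \<epsilon> = (\<lambda>(_, is, c). case index_update_c W is (po is) \<epsilon> of
               (None, c') \<Rightarrow> (False, is, c + c')
             | (Some js, c') \<Rightarrow> (True, js, c + c'))"

text \<open>Every exchange multiplies the volume by more than \<open>1 + \<epsilon>\<close>, so \<open>T\<close> bounds the number of
  remaining iterations.\<close>

lemma main_loop:
  assumes W: "spsd n W" and r: "0 < r" and \<epsilon>: "0 < \<epsilon>"
    and po: "\<And>is. distinct (po is) \<and> set (po is) = set is \<times> ({..<n} - set is)"
    and V: "\<And>js. length js = r \<Longrightarrow> pivot_prod (entry_fun n W) js \<le> V"
    and "is": "distinct is" "set is \<subseteq> {..<n}" "length is = r"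
    and pos: "0 < pivot_prod (entry_fun n W) is"
    and T: "V < pivot_prod (entry_fun n W) is * (1 + \<epsilon>) ^ T"
  shows "\<exists>is' c'. while_option fst (main_step W po \<epsilon>) (True, is, c) = Some (False, is', c')
    \<and> update_loop n W r \<epsilon> (set is) (set is') \<and> c' \<le> c + T * (16 * n * r ^ 3)"
  using "is" pos T
proof (induction T arbitrary: "is" c)
  case 0
  \<comment> \<open>With no iterations left, the assumption on \<open>T\<close> contradicts the
    bound \<open>V\<close>.\<close>
  then show ?case using V[of "is"] by simp
next
  case (Suc T)
  let ?A = "entry_fun n W"
  obtain res cost where run: "index_update_c W is (po is) \<epsilon> = (res, cost)" by fastforce
  have "distinct (po is)" "set (po is) = set is \<times> ({..<n} - set is)" using po by auto
  note spec = index_update_c_spec[OF W Suc.prems(1-3) r Suc.prems(4) this, of \<epsilon>]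
  have cost: "cost \<le> 16 * n * r ^ 3" using spec(2) run by simp
  show ?case
  proof (cases res)
    case None
    then have "main_step W po \<epsilon> (True, is, c) = (False, is, c + cost)"
      by (simp add: main_step_def run)
    \<comment> \<open>Two unfoldings: the failed search clears the flag, and the next test ends the
      loop.\<close>
    then have "while_option fst (main_step W po \<epsilon>) (True, is, c) = Some (False, is, c + cost)"
      by (subst while_option_unfold, simp, subst while_option_unfold, simp)
    moreover have "locally_maximal n W r \<epsilon> (set is)" using spec(1) run None by simp
    then have "update_loop n W r \<epsilon> (set is) (set is)"
      by (intro update_loop.stop) (auto simp: index_update_def locally_maximal_def)
    ultimately show ?thesis using cost by auto
  next
    case (Some js)
    then obtain i j where ij: "i \<in> set is" "j \<in> {..<n} - set is" "js = j # remove1 i is"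
      "improving W (set is) r \<epsilon> (insert j (set is - {i}))"
      using spec(1) run by auto
    have js: "distinct js" "set js = insert j (set is - {i})" "set js \<subseteq> {..<n}" "length js = r"
      using ij Suc.prems(1-3) length_pos_if_in_set[OF ij(1)]
      by (auto simp: set_remove1_eq length_remove1)
    have "pivot_prod ?A js / pivot_prod ?A is > 1 + \<epsilon>"
      using ij(4) proj_volume_submatrix[OF W Suc.prems(1-3)] proj_volume_submatrix[OF W js(1,3,4)]
      unfolding improving_def js(2) by simp
    then have growth: "pivot_prod ?A is * (1 + \<epsilon>) < pivot_prod ?A js"
      using Suc.prems(4) by (simp add: less_divide_eq mult.commute)
    have "0 < pivot_prod ?A is * (1 + \<epsilon>)" using Suc.prems(4) \<epsilon> by simp
    then have posj: "0 < pivot_prod ?A js" using growth by linarith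
    have "V < pivot_prod ?A is * (1 + \<epsilon>) * (1 + \<epsilon>) ^ T" using Suc.prems(5) by (simp add: mult_ac)
    also have "\<dots> \<le> pivot_prod ?A js * (1 + \<epsilon>) ^ T"
      using growth \<epsilon> by (intro mult_right_mono) auto
    finally obtain is' c' where IH:
      "while_option fst (main_step W po \<epsilon>) (True, js, c + cost) = Some (False, is', c')"
      "update_loop n W r \<epsilon> (set js) (set is')" "c' \<le> c + cost + T * (16 * n * r ^ 3)"
      using Suc.IH[OF js(1,3,4) posj, of "c + cost"] by blast
    have "main_step W po \<epsilon> (True, is, c) = (True, js, c + cost)"
      by (simp add: main_step_def run Some)
    then have "while_option fst (main_step W po \<epsilon>) (True, is, c) = Some (False, is', c')"
      using IH(1) by (subst while_option_unfold) simp
    moreover have "index_update n W (set is) r \<epsilon> (set js)"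
      unfolding index_update_def js(2) using ij by blast
    then have "update_loop n W r \<epsilon> (set is) (set is')"
      using js(2) ij(2) by (intro update_loop.continue[OF _ _ IH(2)]) auto
    ultimately show ?thesis using IH(3) cost by auto
  qed
qed

lemma main_c_cost:
  assumes r: "0 < r" and n: "r < n" and W: "spsd n W" and run: "gecp n W r I0"
    and orders: "visiting_orders n pv po" and \<epsilon>: "0 < \<epsilon>" "\<epsilon> \<le> 1 / 2"
  shows "\<exists>is cost. main_c n W pv po r \<epsilon> = Some (is, cost) \<and> main_algorithm n W r r \<epsilon> (set is)
    \<and> real cost \<le> 153 * (real n * real r ^ 4 * inverse \<epsilon> * log 2 (real (max 2 r)))"
proof -
  let ?A = "entry_fun n W" and ?L = "log 2 (real (max 2 r))"
  have A: "psd n ?A" by (rule spsd_psd[OF W])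
  have pv: "distinct (pv t) \<and> set (pv t) = {..<n}" for t
    using orders by (simp add: visiting_orders_def)
  have po: "distinct (po is) \<and> set (po is) = set is \<times> ({..<n} - set is)" for "is"
    using orders by (simp add: visiting_orders_def)
  obtain rs d fs where g: "fst (gecp_c n W pv r) = (rs, d, fs)" by (metis prod_cases3)
  note spec = gecp_c_spec[OF W _ pv g]
  have n0: "0 < n" using n by simp
  have greedy: "greedy n ?A (rev rs)" and len: "length (rev rs) = r" using spec(1,3) n0 by auto
  obtain ks where "length ks = r" "pivot_prod ?A ks \<noteq> 0"
    using run gecp_run_greedy W unfolding gecp_def by blast
  \<comment> \<open>The implementation may break ties differently from the given run. That run
    exhibits a nonzero minor, and the growth bound then forces the product of the pivots chosen here
    to be positive.\<close>
  then have "0 < growth_bound r * pivot_prod ?A (rev rs)"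
    using greedy_pivot_prod_max[OF W greedy len, of ks] pivot_prod_nonneg[OF A, of ks] by linarith
  then have pos: "0 < pivot_prod ?A (rev rs)"
    using pivot_prod_nonneg[OF A, of "rev rs"] by (simp add: zero_less_mult_iff)
  obtain R where "gecp_run n W r (set (rev rs)) R"
    using greedy_gecp_run[OF W greedy] pos len by auto
  \<comment> \<open>A distinct list of length \<open>r\<close> with the same set forces
    \<open>rs\<close> to be distinct as well.\<close>
  then obtain rs' where rs': "distinct rs'" "set rs' = set (rev rs)" "length rs' = r" "set (rev rs) \<subseteq> {..<n}"
    and gecp: "gecp n W r (set rs)"
    using gecp_run_greedy[OF _ W] unfolding gecp_def by (metis set_rev)
  then have rs: "distinct rs" "set rs \<subseteq> {..<n}" "length rs = r"
    using len distinct_card card_distinct by (metis length_rev set_rev)+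
  have pos': "pivot_prod ?A rs = pivot_prod ?A (rev rs)"
    using rs by (intro pivot_prod_cong_set[OF W]) auto
  \<comment> \<open>The 8 is the 4 of \<open>growth_bound_le\<close> times the 2 from
    \<open>\<epsilon> / 2 \<le> ln (1 + \<epsilon>)\<close>; the floor plus 1 exceeds the quotient
    strictly.\<close>
  define T where "T = nat \<lfloor>8 * real r * ?L / \<epsilon>\<rfloor> + 1"
  have L: "1 \<le> ?L" by simp
  have T_gt: "8 * real r * ?L / \<epsilon> < real T"
    unfolding T_def using L \<epsilon> by (simp add: less_floor_iff) linarith
  have T_le: "real T \<le> 8 * real r * ?L / \<epsilon> + 1"
    unfolding T_def using L \<epsilon> by (simp add: of_nat_nat)
  have "growth_bound r < (1 + \<epsilon>) ^ T"
  proof -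
    have "\<epsilon> / 2 \<le> \<epsilon> - \<epsilon>\<^sup>2" using \<epsilon> by (simp add: power2_eq_square field_simps)
    also have "\<dots> \<le> ln (1 + \<epsilon>)" using \<epsilon> by (intro ln_one_plus_pos_lower_bound) auto
    finally have ln: "\<epsilon> / 2 \<le> ln (1 + \<epsilon>)" .
    have "growth_bound r \<le> exp (4 * real r * ?L)" by (rule growth_bound_le[OF r])
    also have "\<dots> < exp (real T * (\<epsilon> / 2))"
      using T_gt \<epsilon> by (simp add: divide_less_eq mult_ac)
    also have "\<dots> \<le> exp (real T * ln (1 + \<epsilon>))" unfolding exp_le_cancel_iff using ln by (intro mult_left_mono) auto
    also have "\<dots> = (1 + \<epsilon>) ^ T" using \<epsilon> by (simp add: exp_of_nat_mult)
    finally show ?thesis .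
  qed
  then have Tpos: "growth_bound r * pivot_prod ?A (rev rs) < pivot_prod ?A rs * (1 + \<epsilon>) ^ T"
    using pos pos' by simp
  define c0 where "c0 = snd (gecp_c n W pv r)"
  obtain js c where loop:
    "while_option fst (main_step W po \<epsilon>) (True, rs, c0) = Some (False, js, c)"
    "update_loop n W r \<epsilon> (set rs) (set js)" "c \<le> c0 + T * (16 * n * r ^ 3)"
    using main_loop[OF W r \<epsilon>(1) po greedy_pivot_prod_max[OF W greedy len] rs _ Tpos, of c0] pos pos'
    by auto
  have "gecp_c n W pv r = ((rs, d, fs), c0)" using g by (simp add: c0_def prod_eq_iff)
  then have "main_c n W pv po r \<epsilon> = Some (js, c)"
    using loop(1) by (simp add: main_c_def main_step_def)
  moreover have "main_algorithm n W r r \<epsilon> (set js)"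
    using gecp loop(2) by (auto simp: main_algorithm_def)
  moreover have "real c \<le> 153 * (real n * real r ^ 4 * inverse \<epsilon> * ?L)"
  proof -
    \<comment> \<open>As \<open>X\<close> is at least 1, it absorbs additive constants. GECP
      contributes 9, and at most \<open>9 * X\<close> iterations of cost
      \<open>16 * n * r ^ 3\<close> contribute 144, together 153.\<close>
    define X where "X = real r * ?L / \<epsilon>"
    have r1: "1 \<le> real r" using r by simp
    have "\<epsilon> \<le> ?L" using L \<epsilon> by linarith
    then have "1 \<le> ?L / \<epsilon>" using \<epsilon> by (simp add: le_divide_eq)
    then have X1: "1 \<le> X" unfolding X_def using r1 mult_mono[of 1 "real r" 1 "?L / \<epsilon>"] by simp
    have "c0 \<le> n * r * (2 * r + 7)" using spec(6) n0 by (simp add: c0_def)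
    also have "\<dots> \<le> n * r * (9 * r ^ 2)"
      using r self_le_power[of r 2] one_le_power[of r 2]
      by (intro mult_le_mono) (auto simp del: self_le_power one_le_power)
    finally have "real c0 \<le> 9 * (real n * real r ^ 3)"
      unfolding of_nat_le_iff[symmetric, where ?'a = real]
      by (simp add: power2_eq_square power3_eq_cube mult_ac)
    also have "\<dots> \<le> 9 * (real n * real r ^ 3) * X"
      using mult_left_mono[OF X1, of "9 * (real n * real r ^ 3)"] by simp
    finally have c0: "real c0 \<le> 9 * (real n * real r ^ 3 * X)" by simp
    have "8 * real r * ?L / \<epsilon> = 8 * X" by (simp add: X_def)
    then have "real T \<le> 9 * X" using T_le X1 by linarith
    then have "real (T * (16 * n * r ^ 3)) \<le> 9 * X * (16 * real n * real r ^ 3)"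
      using mult_right_mono[of "real T" "9 * X" "16 * real n * real r ^ 3"] by (simp add: mult_ac)
    then have "real c \<le> 153 * (real n * real r ^ 3 * X)"
      using c0 of_nat_mono[OF loop(3), where ?'a = real] by (simp add: mult_ac)
    also have "real n * real r ^ 3 * X = real n * real r ^ 4 * inverse \<epsilon> * ?L"
      by (simp add: X_def divide_inverse power_Suc eval_nat_numeral)
    finally show ?thesis .
  qed
  ultimately show ?thesis by blast
qed

theorem theorem6p1:
  shows "(\<forall>(n::nat) (r::nat) (W::real mat) (\<epsilon>::real) (I::nat set).
            0 < r \<and> r < n \<and> 0 < \<epsilon> \<and> spsd n W \<and> main_algorithm n W r r \<epsilon> I \<longrightarrow>
            (\<exists>U. mat_inverse (submatrix W I I) = Some U \<and>
                 cheb_norm (W - submatrix W UNIV I * U * submatrix W I UNIV)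
                   \<le> (1 + \<epsilon>) * real (r + 1) * singular_value W (r + 1)))
       \<and> (\<exists>C>0. \<forall>\<^sub>F \<epsilon> in at_right (0::real).
            \<forall>(n::nat) (r::nat) (W::real mat) pv po.
              0 < r \<and> r < n \<and> spsd n W \<and> (\<exists>I. gecp n W r I) \<and> visiting_orders n pv po \<longrightarrow>
              (\<exists>is cost. main_c n W pv po r \<epsilon> = Some (is, cost)
                 \<and> main_algorithm n W r r \<epsilon> (set is)
                 \<and> real cost \<le> C * (real n * real r ^ 4 * inverse \<epsilon> * log 2 (real (max 2 r)))))"
proof (intro conjI exI[of _ 153])
  \<comment> \<open>One constant serves all \<open>n\<close>, \<open>r\<close>, \<open>W\<close> and
    visiting orders as soon as \<open>\<epsilon>\<close> is at most 1/2.\<close>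
  have "\<forall>\<^sub>F \<epsilon> in at_right (0::real). 0 < \<epsilon> \<and> \<epsilon> \<le> 1 / 2"
    unfolding eventually_at_right_field by (intro exI[of _ "1 / 2"]) auto
  then show "\<forall>\<^sub>F \<epsilon> in at_right (0::real).
            \<forall>(n::nat) (r::nat) (W::real mat) pv po.
              0 < r \<and> r < n \<and> spsd n W \<and> (\<exists>I. gecp n W r I) \<and> visiting_orders n pv po \<longrightarrow>
              (\<exists>is cost. main_c n W pv po r \<epsilon> = Some (is, cost)
                 \<and> main_algorithm n W r r \<epsilon> (set is)
                 \<and> real cost \<le> 153 * (real n * real r ^ 4 * inverse \<epsilon> * log 2 (real (max 2 r))))"
    by eventually_elim (use main_c_cost in blast)
qed (use main_algorithm_error in auto)

end
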